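(* Let $M$ be chosen from the Haar probability measure of $SO(n,\mathbb{R})$ and let $j\ge 1$ be an integer. Let $W(M)=\frac{\mathrm{Tr}(M^j)}{\sqrt{j}}$ if $j$ is odd and $W(M)=\frac{\mathrm{Tr}(M^j)-1}{\sqrt{j}}$ if $j$ is even. Then $$\left|\mathbb{P}(W\le x_0)-\frac{1}{\sqrt{2\pi}}\int_{-\infty}^{x_0}e^{-x^2/2}\,dx\right| = O(j/n),$$ that is, there is an absolute constant $C>0$ such that for all integers $n\ge 1$, $j\ge 1$ and all real $x_0$ the left-hand side is at most $Cj/n$.
   Context: $SO(n,\mathbb{R})$ is the group of real $n\times n$ orthogonal matrices of determinant $1$. The integer $j$ is allowed to grow with $n$; the implied constant does not depend on $j$, $n$ or $x_0$. *)

theory Defs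
  imports
    "HOL-Probability.Probability_Measure"
    "HOL-Analysis.Set_Integral"
    "Jordan_Normal_Form.Determinant"
begin

text \<open>
  Matrices are those of Jordan_Normal_Form, whose size is a term and not a type, so that
  one formula can quantify over all \<open>n\<close>.
\<close>

definition SO :: "nat \<Rightarrow> real mat set" where
  "SO n = {A \<in> carrier_mat n n. transpose_mat A * A = 1\<^sub>m n \<and> Determinant.det A = 1}"

definition mat_trace :: "real mat \<Rightarrow> real" where
  "mat_trace A = (\<Sum>i<dim_row A. A $$ (i, i))"

text \<open>
  The Borel sigma-algebra of \<open>SO n\<close> as a subspace of the Euclidean space of \<open>n \<times> n\<close> matrices:
  the Borel sets of that Euclidean space form the finite product of the Borel sigma-algebras
  of the entries, and they are pulled back along the embedding that sends a matrix to its
  family of entries. Only the measurable space matters here.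
\<close>

definition SO_borel :: "nat \<Rightarrow> real mat measure" where
  "SO_borel n = vimage_algebra (SO n)
     (\<lambda>A. \<lambda>p\<in>{..<n} \<times> {..<n}. A $$ p)
     (Pi\<^sub>M ({..<n} \<times> {..<n}) (\<lambda>_. borel))"

text \<open>
  Invariance under left translations determines the measure, and right invariance follows,
  because \<open>SO n\<close> is compact. Regularity is automatic for a finite Borel measure on a compact
  metric space. The lemma \<open>measurable_SO_translate\<close> below shows that \<open>distr\<close> is applied
  only to measurable maps.
\<close>

definition haar_prob_SO :: "nat \<Rightarrow> real mat measure \<Rightarrow> bool" where
  "haar_prob_SO n \<mu> \<longleftrightarrow>
     prob_space \<mu> \<and> space \<mu> = SO n \<and> sets \<mu> = sets (SO_borel n) \<and>
     (\<forall>A\<in>SO n. distr \<mu> \<mu> (\<lambda>B. A * B) = \<mu>)"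

definition W :: "nat \<Rightarrow> real mat \<Rightarrow> real" where
  "W j M = (if odd j then mat_trace (M ^\<^sub>m j) / sqrt (real j)
            else (mat_trace (M ^\<^sub>m j) - 1) / sqrt (real j))"

lemma space_SO_borel [simp]: "space (SO_borel n) = SO n"
  by (simp add: SO_borel_def)

lemma SO_carrier: "A \<in> SO n \<Longrightarrow> A \<in> carrier_mat n n"
  by (simp add: SO_def)

lemma SO_mult:
  assumes "A \<in> SO n" "B \<in> SO n"
  shows "A * B \<in> SO n"
proof -
  have c: "A \<in> carrier_mat n n" "B \<in> carrier_mat n n"
    using assms by (auto simp: SO_def)
  have "transpose_mat (A * B) * (A * B) = (transpose_mat B * transpose_mat A) * (A * B)"
    using c by (simp add: transpose_mult)
  also have "\<dots> = transpose_mat B * (transpose_mat A * (A * B))"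
    using c by (intro assoc_mult_mat) auto
  also have "transpose_mat A * (A * B) = transpose_mat A * A * B"
    using c by (intro assoc_mult_mat[symmetric]) auto
  also have "\<dots> = B" using assms c by (simp add: SO_def)
  also have "transpose_mat B * B = 1\<^sub>m n" using assms by (simp add: SO_def)
  finally show ?thesis
    using assms c by (simp add: SO_def Determinant.det_mult)
qed

lemma measurable_SO_entry:
  assumes "i < n" "k < n"
  shows "(\<lambda>A. A $$ (i, k)) \<in> borel_measurable (SO_borel n)"
proof -
  let ?I = "{..<n} \<times> {..<n}"
  have "(\<lambda>A. \<lambda>p\<in>?I. A $$ p) \<in> measurable (SO_borel n) (Pi\<^sub>M ?I (\<lambda>_. borel :: real measure))"
    unfolding SO_borel_def by (rule measurable_vimage_algebra1) (auto simp: space_PiM)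
  from measurable_compose[OF this measurable_component_singleton[of "(i, k)" ?I]]
  show ?thesis using assms by simp
qed

lemma measurable_SO_translate:
  assumes "A \<in> SO n"
  shows "(\<lambda>B. A * B) \<in> measurable (SO_borel n) (SO_borel n)"
proof -
  let ?I = "{..<n} \<times> {..<n}"
  have "(\<lambda>B. \<lambda>p\<in>?I. (A * B) $$ p) \<in> measurable (SO_borel n) (Pi\<^sub>M ?I (\<lambda>_. borel :: real measure))"
  proof (rule measurable_restrict)
    fix p assume "p \<in> ?I"
    then obtain i k where p: "p = (i, k)" "i < n" "k < n" by auto
    have eq: "(A * B) $$ p = (\<Sum>l<n. A $$ (i, l) * B $$ (l, k))" if "B \<in> SO n" for B
      using SO_carrier[OF assms] SO_carrier[OF that] p
      by (auto simp: scalar_prod_def lessThan_atLeast0)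
    have "(\<lambda>B. \<Sum>l<n. A $$ (i, l) * B $$ (l, k)) \<in> borel_measurable (SO_borel n)"
      using p by (intro borel_measurable_sum borel_measurable_times borel_measurable_const
        measurable_SO_entry) auto
    then show "(\<lambda>B. (A * B) $$ p) \<in> borel_measurable (SO_borel n)"
      using eq by (subst measurable_cong[where g = "\<lambda>B. \<Sum>l<n. A $$ (i, l) * B $$ (l, k)"]) auto
  qed
  then have "(\<lambda>B. A * B) \<in> measurable (SO_borel n)
      (vimage_algebra (SO n) (\<lambda>A. \<lambda>p\<in>?I. A $$ p) (Pi\<^sub>M ?I (\<lambda>_. borel)))"
    by (intro measurable_vimage_algebra2) (auto intro: SO_mult[OF assms])
  then show ?thesis by (simp add: SO_borel_def)
qed

end

theory Submission
  imports Defs "HOL-Probability.Distributions"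
begin

text \<open>
  Write \<open>p\<^sub>j = Tr (M\<^sup>j)\<close>. The proof is Stein's method, driven by one integration by parts formula on
  the group. Left invariance of the Haar measure says that the integral of a smooth \<open>F (g M)\<close> does not
  depend on \<open>g\<close>; differentiating along the rotations of the coordinate planes shows that every
  derivative \<open>X F\<close> has integral \<open>0\<close>. Applied to \<open>F X p\<^sub>j\<close> and summed over the planes, this gives
  the Schwinger-Dyson equation (lemma \<open>schwinger_dyson\<close>)

    \<open>E [F ((n - 1) p\<^sub>j + (\<Sum>l=1..<j. p\<^sub>l p\<^bsub>j-l\<^esub> - p\<^bsub>|j-2l|\<^esub>))] = E [\<Gamma>(F, p\<^sub>j)] / j\<close>,

  where \<open>\<Gamma>\<close> is the carre du champ, for which \<open>\<Gamma>(p\<^sub>i, p\<^sub>j) = i j (p\<^bsub>|i-j|\<^esub> - p\<^bsub>i+j\<^esub>)\<close>, and \<open>p\<^sub>0 = n\<close>.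
  The bracket is \<open>(n - 1) q + S\<close>, where \<open>q\<close> is \<open>p\<^sub>j\<close> minus its Gaussian mean
  (\<open>1\<close> for even \<open>j\<close>, else \<open>0\<close>) and the defect \<open>S\<close> collects everything else. With
  \<open>F = f (W)\<close> and \<open>W = q / sqrt j\<close> it becomes

    \<open>E [f' W - W f W] = (E [f W S] / sqrt j - E [f' W (1 - p\<^bsub>2j\<^esub>)]) / (n - 1)\<close>,

  so a Kolmogorov bound of order \<open>j / n\<close> follows once \<open>E |S|\<close> is of order \<open>j\<^bsup>3/2\<^esup>\<close> and
  \<open>E |1 - p\<^bsub>2j\<^esub>|\<close> is of order \<open>j\<close>. Only \<open>4 j < n\<close> matters: otherwise the bound with \<open>C = 20\<close> exceeds \<open>1\<close>.

  The second estimate is a second moment. For the first, apply the equation to \<open>F = S\<close>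
  and to \<open>F = q\<close>. If \<open>E [q\<^sup>2] = j\<close> and \<open>E p\<^bsub>2j\<^esub> = 1\<close> hold exactly, then \<open>E [q S] = 0\<close>, and
  \<open>E [S\<^sup>2] = E [\<Gamma>(S, p\<^sub>j)] / j\<close>, which again involves only first and second moments and is at most
  \<open>3 j\<^sup>3\<close> (lemma \<open>expectation_defect_square\<close>).

  The exact moments come from the same equation with \<open>F\<close> a product of traces. It expresses the moment
  of a list of exponents through moments of lower degree and moments of the same degree with small
  coefficients. The moments of independent Gaussians with mean \<open>0\<close> or \<open>1\<close> and variance \<open>j\<close> solve the same
  system (lemma \<open>gmom_schwinger_dyson\<close>). The difference of two solutions vanishes in degree
  below \<open>n\<close> by a maximum principle: in degree \<open>d\<close> the coefficient \<open>n - 1\<close> of the leading moment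
  exceeds the sum \<open>d - 1\<close> of the absolute values of the others (lemma \<open>schwinger_dyson_unique\<close>).

  The test functions \<open>f\<close> solve Stein's equation \<open>f' x - x f x = h x - E [h Z]\<close>, with \<open>Z\<close> standard normal,
  for piecewise linear ramps \<open>h\<close>, so that \<open>f\<close> is differentiable everywhere; the bounds on \<open>f\<close> and \<open>f'\<close>
  do not depend on the slope, and letting the ramps become steep gives the distribution function.
\<close>

section \<open>Sums over the removal of one list entry\<close>

text \<open>
  A product of traces is encoded by the list of its exponents. The Leibniz rule, the Gaussian
  integration by parts formula and the Schwinger-Dyson equation all sum over the ways of removing one
  factor \<open>i\<close>, leaving the list \<open>ys\<close>; \<open>g i ys\<close> is the contribution of that factor.
\<close>

primrec del_sum :: "'a list \<Rightarrow> ('a \<Rightarrow> 'a list \<Rightarrow> real) \<Rightarrow> real" where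
  "del_sum [] g = 0"
| "del_sum (x # xs) g = g x xs + del_sum xs (\<lambda>i ys. g i (x # ys))"

lemma set_of_deletion: "mset xs = add_mset i (mset ys) \<Longrightarrow> set xs = insert i (set ys)"
  by (metis set_mset_add_mset_insert set_mset_mset)

lemma sum_list_of_deletion:
  "mset xs = add_mset i (mset ys) \<Longrightarrow> sum_list xs = i + sum_list (ys :: nat list)"
  by (drule arg_cong[where f = sum_mset]) (simp add: sum_mset_sum_list)

lemma del_sum_cong_mset:
  assumes "\<And>i ys. mset xs = add_mset i (mset ys) \<Longrightarrow> g i ys = h i ys"
  shows "del_sum xs g = del_sum xs h"
  using assms
proof (induction xs arbitrary: g h)
  case (Cons x xs)
  have "del_sum xs (\<lambda>i ys. g i (x # ys)) = del_sum xs (\<lambda>i ys. h i (x # ys))"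
    by (rule Cons.IH) (auto intro!: Cons.prems)
  then show ?case using Cons.prems[of x xs] by simp
qed simp

text \<open>
  This form lets recursive calls occur under \<open>del_sum\<close>: the remaining list is shorter.
\<close>

lemma del_sum_cong [fundef_cong]:
  assumes "xs = xs'" "\<And>i ys. length xs' = Suc (length ys) \<Longrightarrow> g i ys = h i ys"
  shows "del_sum xs g = del_sum xs' h"
  unfolding assms(1)
proof (rule del_sum_cong_mset)
  fix i ys assume "mset xs' = add_mset i (mset ys)"
  then have "size (mset xs') = size (add_mset i (mset ys))" by (rule arg_cong)
  then show "g i ys = h i ys" by (intro assms(2)) simp
qed

lemma del_sum_add: "del_sum xs (\<lambda>i ys. g i ys + h i ys) = del_sum xs g + del_sum xs h"
  by (induction xs arbitrary: g h) auto

lemma del_sum_diff: "del_sum xs (\<lambda>i ys. g i ys - h i ys) = del_sum xs g - del_sum xs h"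
  by (induction xs arbitrary: g h) auto

lemma del_sum_mult: "del_sum xs (\<lambda>i ys. c * g i ys) = c * del_sum xs g"
  by (induction xs arbitrary: g) (auto simp: algebra_simps)

lemma del_sum_sum: "del_sum xs (\<lambda>i ys. \<Sum>a\<in>A. g a i ys) = (\<Sum>a\<in>A. del_sum xs (g a))"
  by (induction xs arbitrary: g) (auto simp: sum.distrib)

lemma del_sum_zero [simp]: "del_sum xs (\<lambda>i ys. 0) = 0"
  by (induction xs) auto

text \<open>
  Second derivatives commute.
\<close>

lemma del_sum_swap:
  "del_sum xs (\<lambda>i ys. del_sum ys (\<lambda>k zs. g i k zs)) = del_sum xs (\<lambda>i ys. del_sum ys (\<lambda>k zs. g k i zs))"
  by (induction xs arbitrary: g) (auto simp: del_sum_add)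

lemma del_sum_abs_le:
  assumes "\<And>i ys. mset xs = add_mset i (mset ys) \<Longrightarrow> \<bar>g i ys\<bar> \<le> h i ys"
  shows "\<bar>del_sum xs g\<bar> \<le> del_sum xs h"
  using assms
proof (induction xs arbitrary: g h)
  case (Cons x xs)
  have "\<bar>del_sum xs (\<lambda>i ys. g i (x # ys))\<bar> \<le> del_sum xs (\<lambda>i ys. h i (x # ys))"
    by (rule Cons.IH) (auto intro!: Cons.prems)
  then show ?case using Cons.prems[of x xs] by auto
qed simp

lemma del_sum_real: "del_sum xs (\<lambda>i ys. real i) = real (sum_list xs)"
  by (induction xs) auto

section \<open>Gaussian moments and the Schwinger-Dyson equation\<close>

definition gap :: "nat \<Rightarrow> nat \<Rightarrow> nat" where "gap a b = (a - b) + (b - a)"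

text \<open>
  The value at \<open>j = 0\<close> encodes \<open>Tr (M\<^sup>0) = n\<close>, so that exponents \<open>\<bar>j - 2 l\<bar> = 0\<close> need no separate
  treatment in the identities below.
\<close>

definition mean_pow :: "nat \<Rightarrow> nat \<Rightarrow> real" where
  "mean_pow n j = (if j = 0 then real n else if even j then 1 else 0)"

text \<open>
  The moments of independent Gaussians \<open>P\<^sub>j\<close> with mean \<open>mean_pow n j\<close> and variance \<open>j\<close>, defined through
  \<open>E [P\<^sub>j F] = E P\<^sub>j E F + j E [\<partial>\<^sub>j F]\<close>.
\<close>

fun gmom :: "nat \<Rightarrow> nat list \<Rightarrow> real" where
  "gmom n [] = 1"
| "gmom n (j # xs) = mean_pow n j * gmom n xs
     + real j * del_sum xs (\<lambda>i ys. if i = j then gmom n ys else 0)"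

definition gmom_deriv :: "nat \<Rightarrow> nat \<Rightarrow> nat list \<Rightarrow> real" where
  "gmom_deriv n a xs = del_sum xs (\<lambda>i ys. if i = a then gmom n ys else 0)"

lemma gmom_Cons: "gmom n (a # xs) = mean_pow n a * gmom n xs + real a * gmom_deriv n a xs"
  by (simp add: gmom_deriv_def)

text \<open>
  Gaussian integration by parts in two variables, with the result sorted by the order of the
  derivative of the remaining product.
\<close>

lemma gmom_Cons2:
  "gmom n (a # b # xs) = mean_pow n a * mean_pow n b * gmom n xs
     + (if a = b then real a * gmom n xs else 0)
     + mean_pow n a * real b * gmom_deriv n b xs + mean_pow n b * real a * gmom_deriv n a xs
     + real a * real b * del_sum xs (\<lambda>i ys. if i = a then gmom_deriv n b ys else 0)"
proof -
  have "gmom_deriv n a (b # xs) = (if b = a then gmom n xs else 0)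
      + del_sum xs (\<lambda>i ys. if i = a then gmom n (b # ys) else 0)"
    by (simp add: gmom_deriv_def)
  also have "del_sum xs (\<lambda>i ys. if i = a then gmom n (b # ys) else 0)
    = del_sum xs (\<lambda>i ys. mean_pow n b * (if i = a then gmom n ys else 0)
        + real b * (if i = a then gmom_deriv n b ys else 0))"
    by (rule del_sum_cong_mset) (auto simp: gmom_deriv_def)
  also have "\<dots> = mean_pow n b * gmom_deriv n a xs
      + real b * del_sum xs (\<lambda>i ys. if i = a then gmom_deriv n b ys else 0)"
    by (simp only: del_sum_add del_sum_mult gmom_deriv_def)
  finally show ?thesis
    by (simp only: gmom_Cons[of n a "b # xs"] gmom_Cons[of n b xs]) (simp add: algebra_simps)
qed

lemma sum_not_even: "(\<Sum>l=1..<2*m. if even l then 0 else 1 :: real) = real m"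
  by (induction m) auto

text \<open>
  The terms of the Schwinger-Dyson equation that do not differentiate the remaining product.
  For even \<open>j\<close> the middle index \<open>l = j / 2\<close> contributes \<open>p\<^sub>0 = n\<close>, which produces the mean of \<open>p\<^sub>j\<close>.
\<close>

lemma mean_pow_balance:
  assumes "j \<ge> 1"
  shows "(\<Sum>l=1..<j. mean_pow n (gap j (2*l)) - mean_pow n l * mean_pow n (j - l)
            - (if l = j - l then real l else 0)) = (real n - 1) * mean_pow n j"
proof (cases "even j")
  case False
  then have "mean_pow n (gap j (2*l)) - mean_pow n l * mean_pow n (j - l)
            - (if l = j - l then real l else 0) = 0" if "l \<in> {1..<j}" for l
    using that by (auto simp: mean_pow_def gap_def)
  then have "(\<Sum>l=1..<j. mean_pow n (gap j (2*l)) - mean_pow n l * mean_pow n (j - l)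
            - (if l = j - l then real l else 0)) = 0" by (rule sum.neutral[OF ballI])
  then show ?thesis using False assms by (auto simp: mean_pow_def)
next
  case True
  then obtain m where m: "j = 2 * m" by (rule evenE)
  have "(\<Sum>l=1..<j. mean_pow n (gap j (2*l)) - mean_pow n l * mean_pow n (j - l)
            - (if l = j - l then real l else 0))
      = (\<Sum>l=1..<j. (if even l then 0 else 1) + (if l = m then real n - 1 - real m else 0))"
  proof (rule sum.cong)
    fix l assume "l \<in> {1..<j}"
    then show "mean_pow n (gap j (2*l)) - mean_pow n l * mean_pow n (j - l)
            - (if l = j - l then real l else 0)
         = (if even l then 0 else 1) + (if l = m then real n - 1 - real m else 0)"
      using m by (cases "even l") (auto simp: mean_pow_def gap_def)
  qed simp
  also have "\<dots> = real m + (real n - 1 - real m)"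
    using m assms by (simp only: sum.distrib sum_not_even) (auto simp: sum.delta)
  finally show ?thesis using m assms by (simp add: mean_pow_def)
qed

lemma sum_gap_eq:
  assumes "i \<ge> 1"
  shows "(\<Sum>l=1..<j. if i = gap j (2*l) then real i else 0)
     = (if i < j \<and> even (j - i) then 2 * real i else 0)"
proof -
  have "(\<Sum>l=1..<j. if i = gap j (2*l) then real i else 0)
      = (\<Sum>l\<in>{l\<in>{1..<j}. i = gap j (2*l)}. real i)"
    by (rule sum.inter_filter[symmetric]) simp
  also have "\<dots> = real i * real (card {l\<in>{1..<j}. i = gap j (2*l)})"
    by (simp only: sum_constant mult.commute)
  also have "card {l\<in>{1..<j}. i = gap j (2*l)} = (if i < j \<and> even (j - i) then 2 else 0)"
  proof (cases "i < j \<and> even (j - i)")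
    case True
    then obtain k where "j - i = 2 * k" by (elim conjE evenE)
    with True have k: "j = i + 2 * k" "k \<ge> 1" by auto
    have "{l\<in>{1..<j}. i = gap j (2*l)} = {k, i + k}"
      using k assms by (auto simp: gap_def)
    moreover have "card {k, i + k} = 2" using assms by simp
    ultimately show ?thesis using True by (simp only: if_P)
  next
    case False
    have "i < j \<and> even (j - i)" if l: "l \<in> {1..<j}" "i = gap j (2*l)" for l
    proof (cases "2 * l \<le> j")
      case True
      then have "j - i = 2 * l" "i < j" using l by (auto simp: gap_def)
      then show ?thesis by simp
    next
      case False
      then have "j - i = 2 * (j - l)" "i < j" using l by (auto simp: gap_def)
      then show ?thesis by simp
    qed
    then have "{l\<in>{1..<j}. i = gap j (2*l)} = {}" using False by blast
    then show ?thesis by (simp only: if_not_P[OF False] card.empty)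
  qed
  finally show ?thesis
    by (cases "i < j \<and> even (j - i)")
      (simp_all only: simp_thms if_True if_False of_nat_numeral of_nat_0 mult_zero_right mult.commute)
qed

text \<open>
  The coefficient of the first derivative in direction \<open>i\<close>. For \<open>i < j\<close> of the same parity the split
  exponents \<open>\<bar>j - 2 l\<bar>\<close> hit \<open>i\<close> twice, once on each side of \<open>j / 2\<close>, and cancel the products of a mean with
  a derivative, while for opposite parity every term vanishes;
  for \<open>i = j\<close> what remains is \<open>p\<^sub>0 = n\<close> and the mean of \<open>p\<^bsub>2j\<^esub>\<close>; for \<open>i > j\<close> the two merged exponents
  have the same parity.
\<close>

lemma deriv_coeff_balance:
  assumes "j \<ge> 1"
  shows "(\<Sum>l=1..<j. (if i = gap j (2*l) then real i else 0)
            - (if i = j - l then mean_pow n l * real i else 0)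
            - (if i = l then mean_pow n (j - l) * real i else 0))
         + real i * (mean_pow n (gap i j) - mean_pow n (i + j))
       = (real n - 1) * (if i = j then real j else 0)"
proof (cases "i = 0")
  case True
  then show ?thesis using assms by (auto intro!: sum.neutral)
next
  case False
  then have i: "i \<ge> 1" by simp
  have a: "(\<Sum>l=1..<j. if i = j - l then mean_pow n l * real i else 0)
     = (if i < j then mean_pow n (j - i) * real i else 0)"
  proof -
    have "(\<Sum>l=1..<j. if i = j - l then mean_pow n l * real i else 0)
      = (\<Sum>l=1..<j. if l = j - i \<and> i < j then mean_pow n l * real i else 0)"
      using i by (intro sum.cong) auto
    also have "\<dots> = (if i < j then mean_pow n (j - i) * real i else 0)"
      using i by (cases "i < j") auto
    finally show ?thesis .
  qed
  have b: "(\<Sum>l=1..<j. if i = l then mean_pow n (j - l) * real i else 0)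
     = (if i < j then mean_pow n (j - i) * real i else 0)"
    using i by auto
  show ?thesis
    using i assms unfolding sum_subtractf a b sum_gap_eq[OF i]
    by (auto simp: mean_pow_def gap_def)
qed

text \<open>
  After integrating by parts, the terms are sorted by the order of the derivative. Orders zero and one
  are the two balance lemmas. In order two the splitting terms cancel the merges with \<open>i < j\<close>, and the
  merges \<open>i - j\<close> with \<open>i > j\<close> cancel the merges \<open>i + j\<close>, because removing two factors is symmetric in
  their order.
\<close>

theorem gmom_schwinger_dyson:
  assumes "j \<ge> 1"
  shows "(real n - 1) * gmom n (j # xs)
     = (\<Sum>l=1..<j. gmom n (gap j (2*l) # xs) - gmom n (l # (j - l) # xs))
     + del_sum xs (\<lambda>i ys. real i * (gmom n (gap i j # ys) - gmom n ((i + j) # ys)))"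
proof -
  let ?m = "mean_pow n" and ?G = "gmom n" and ?D = "gmom_deriv n"
  let ?S = "\<lambda>F. del_sum xs F"
  have lin: "c * ?D a xs = ?S (\<lambda>i ys. (if i = a then c else 0) * ?G ys)" for c a
    unfolding gmom_deriv_def del_sum_mult[symmetric]
    by (rule del_sum_cong_mset) auto
  have split: "?G (gap j (2*l) # xs) - ?G (l # (j - l) # xs)
     = (?m (gap j (2*l)) - ?m l * ?m (j - l) - (if l = j - l then real l else 0)) * ?G xs
     + ?S (\<lambda>i ys. ((if i = gap j (2*l) then real i else 0)
            - (if i = j - l then ?m l * real i else 0)
            - (if i = l then ?m (j - l) * real i else 0)) * ?G ys)
     - ?S (\<lambda>i ys. if i = l then real l * real (j - l) * ?D (j - l) ys else 0)" for l
  proof -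
    have e: "?S (\<lambda>i ys. ((if i = gap j (2*l) then real i else 0)
            - (if i = j - l then ?m l * real i else 0)
            - (if i = l then ?m (j - l) * real i else 0)) * ?G ys)
      = ?S (\<lambda>i ys. (if i = gap j (2*l) then real (gap j (2*l)) else 0) * ?G ys)
        - ?S (\<lambda>i ys. (if i = j - l then ?m l * real (j - l) else 0) * ?G ys)
        - ?S (\<lambda>i ys. (if i = l then ?m (j - l) * real l else 0) * ?G ys)"
      unfolding del_sum_diff[symmetric]
      by (rule del_sum_cong_mset) (auto simp: algebra_simps)
    have f: "real l * real (j - l) * ?S (\<lambda>i ys. if i = l then ?D (j - l) ys else 0)
      = ?S (\<lambda>i ys. if i = l then real l * real (j - l) * ?D (j - l) ys else 0)"
      unfolding del_sum_mult[symmetric] by (rule del_sum_cong_mset) auto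
    show ?thesis
      unfolding gmom_Cons2 gmom_Cons[of n "gap j (2*l)"] e lin[symmetric] f
      by (auto simp: algebra_simps)
  qed
  have merge: "?S (\<lambda>i ys. real i * (?G (gap i j # ys) - ?G ((i + j) # ys)))
     = ?S (\<lambda>i ys. (real i * (?m (gap i j) - ?m (i + j))) * ?G ys)
     + ?S (\<lambda>i ys. if i < j then real i * real (j - i) * ?D (j - i) ys else 0)
     + (?S (\<lambda>i ys. if j < i then real i * real (i - j) * ?D (i - j) ys else 0)
     - ?S (\<lambda>i ys. real i * real (i + j) * ?D (i + j) ys))"
    unfolding del_sum_add[symmetric] del_sum_diff[symmetric] gmom_Cons
    by (rule del_sum_cong_mset) (auto simp: gap_def algebra_simps)
  have sym: "?S (\<lambda>i ys. if j < i then real i * real (i - j) * ?D (i - j) ys else 0)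
     = ?S (\<lambda>i ys. real i * real (i + j) * ?D (i + j) ys)"
  proof -
    have "?S (\<lambda>i ys. if j < i then real i * real (i - j) * ?D (i - j) ys else 0)
      = ?S (\<lambda>i ys. del_sum ys (\<lambda>k zs. if i = k + j then real i * real k * ?G zs else 0))"
    proof (rule del_sum_cong_mset)
      fix i ys
      show "(if j < i then real i * real (i - j) * ?D (i - j) ys else 0)
        = del_sum ys (\<lambda>k zs. if i = k + j then real i * real k * ?G zs else 0)"
      proof (cases "j < i")
        case True
        then show ?thesis
          unfolding gmom_deriv_def del_sum_mult[symmetric]
          by (auto intro!: del_sum_cong_mset)
      next
        case False
        have "del_sum ys (\<lambda>k zs. if i = k + j then real i * real k * ?G zs else 0)
          = del_sum ys (\<lambda>k zs. 0)"
          using False by (intro del_sum_cong_mset) auto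
        then show ?thesis using False by simp
      qed
    qed
    also have "\<dots> = ?S (\<lambda>i ys. del_sum ys (\<lambda>k zs. if k = i + j then real k * real i * ?G zs else 0))"
      by (rule del_sum_swap)
    also have "\<dots> = ?S (\<lambda>i ys. real i * real (i + j) * ?D (i + j) ys)"
      unfolding gmom_deriv_def del_sum_mult[symmetric]
      by (intro del_sum_cong_mset) auto
    finally show ?thesis .
  qed
  have second: "(\<Sum>l=1..<j. ?S (\<lambda>i ys. if i = l then real l * real (j - l) * ?D (j - l) ys else 0))
     = ?S (\<lambda>i ys. if i < j then real i * real (j - i) * ?D (j - i) ys else 0)"
    unfolding del_sum_sum[symmetric]
    by (rule del_sum_cong_mset) auto
  have first: "(\<Sum>l=1..<j. ?S (\<lambda>i ys. ((if i = gap j (2*l) then real i else 0)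
            - (if i = j - l then ?m l * real i else 0)
            - (if i = l then ?m (j - l) * real i else 0)) * ?G ys))
     + ?S (\<lambda>i ys. (real i * (?m (gap i j) - ?m (i + j))) * ?G ys)
     = (real n - 1) * (real j * ?D j xs)"
  proof -
    have "(real n - 1) * (real j * ?D j xs)
      = ?S (\<lambda>i ys. ((real n - 1) * (if i = j then real j else 0)) * ?G ys)"
      unfolding lin del_sum_mult[symmetric]
      by (rule del_sum_cong_mset) auto
    then show ?thesis
      unfolding deriv_coeff_balance[OF assms, symmetric] distrib_right sum_distrib_right
        del_sum_sum del_sum_add by simp
  qed
  show ?thesis
    unfolding split sum_subtractf sum.distrib second merge sym
    unfolding sum_distrib_right[symmetric] mean_pow_balance[OF assms]
    using first by (simp add: gmom_Cons algebra_simps del: gmom.simps)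
qed

text \<open>
  Maximum principle, by induction on the degree \<open>d\<close>. Apply the equation to the list of degree \<open>d\<close>
  on which the error is largest. Splits into \<open>\<bar>j - 2 l\<bar>\<close> and merges into \<open>\<bar>i - j\<bar>\<close> lower the degree and
  drop out. What remains are \<open>j - 1\<close> splits and merges of total weight \<open>d - j\<close>, altogether \<open>d - 1 < n - 1\<close>.
\<close>

theorem schwinger_dyson_unique:
  fixes E :: "nat list \<Rightarrow> real"
  assumes nil: "E [] = 1" and zero: "\<And>xs. E (0 # xs) = real n * E xs"
    and sd: "\<And>j xs. j \<ge> 1 \<Longrightarrow> (real n - 1) * E (j # xs)
     = (\<Sum>l=1..<j. E (gap j (2*l) # xs) - E (l # (j - l) # xs))
     + del_sum xs (\<lambda>i ys. real i * (E (gap i j # ys) - E ((i + j) # ys)))"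
    and "0 \<notin> set xs" "sum_list xs < n"
  shows "E xs = gmom n xs"
  using assms(4,5)
proof (induction "sum_list xs" arbitrary: xs rule: less_induct)
  case (less xs)
  define d where "d = sum_list xs"
  define D where "D = (\<lambda>xs. E xs - gmom n xs)"
  define L where "L = {xs. 0 \<notin> set xs \<and> sum_list xs = d}"
  have lower: "D ys = 0" if "0 \<notin> set ys" "sum_list ys < d" for ys
    using less.hyps[of ys] that less.prems by (simp add: D_def d_def)
  have len: "length ys \<le> sum_list ys" if "0 \<notin> set ys" for ys :: "nat list"
    using that by (induction ys) (auto simp: Suc_le_eq)
  have mem: "y \<le> sum_list ys" if "y \<in> set ys" for y and ys :: "nat list"
    using that by (induction ys) auto
  have "L \<subseteq> {ys. set ys \<subseteq> {..d} \<and> length ys \<le> d}"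
    using len mem by (auto simp: L_def)
  then have finL: "finite L"
    by (rule finite_subset) (rule finite_lists_length_le, simp)
  have xsL: "xs \<in> L" using less.prems by (simp add: L_def d_def)
  define m where "m = Max ((\<lambda>xs. \<bar>D xs\<bar>) ` L)"
  have le_m: "\<bar>D ys\<bar> \<le> m" if "ys \<in> L" for ys
    unfolding m_def using finL that by auto
  have "m \<in> (\<lambda>xs. \<bar>D xs\<bar>) ` L"
    unfolding m_def using finL xsL by (intro Max_in) auto
  then obtain zs where zs: "zs \<in> L" "m = \<bar>D zs\<bar>" by auto
  have D0: "D (0 # ys) = real n * D ys" for ys
    by (simp add: D_def zero mean_pow_def algebra_simps)
  have "m \<le> 0"
  proof (cases zs)
    case Nil
    then show ?thesis using zs by (simp add: D_def nil)
  next
    case (Cons j ys)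
    have j: "j \<ge> 1" and ys0: "0 \<notin> set ys" and jd: "j + sum_list ys = d"
      using zs(1) Cons by (auto simp: L_def)
    have "(real n - 1) * D (j # ys)
     = (\<Sum>l=1..<j. D (gap j (2*l) # ys) - D (l # (j - l) # ys))
     + del_sum ys (\<lambda>i zs. real i * (D (gap i j # zs) - D ((i + j) # zs)))"
      unfolding D_def right_diff_distrib sd[OF j] gmom_schwinger_dyson[OF j]
        sum_subtractf del_sum_diff by simp
    also have "(\<Sum>l=1..<j. D (gap j (2*l) # ys) - D (l # (j - l) # ys))
        = (\<Sum>l=1..<j. - D (l # (j - l) # ys))"
    proof (rule sum.cong)
      fix l assume l: "l \<in> {1..<j}"
      have "D (gap j (2*l) # ys) = 0"
      proof (cases "gap j (2*l) = 0")
        case True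
        then show ?thesis using j ys0 jd by (simp add: D0 lower)
      next
        case False
        have "gap j (2*l) < j" using l by (auto simp: gap_def)
        then show ?thesis using False ys0 jd by (intro lower) auto
      qed
      then show "D (gap j (2*l) # ys) - D (l # (j - l) # ys) = - D (l # (j - l) # ys)"
        by simp
    qed simp
    also have "del_sum ys (\<lambda>i zs. real i * (D (gap i j # zs) - D ((i + j) # zs)))
       = del_sum ys (\<lambda>i zs. real i * (- D ((i + j) # zs)))"
    proof (rule del_sum_cong_mset)
      fix i zs assume "mset ys = add_mset i (mset zs)"
      then have "set ys = insert i (set zs)" "sum_list ys = i + sum_list zs"
        by (rule set_of_deletion, rule sum_list_of_deletion)
      then have z: "0 \<notin> set zs" "i \<noteq> 0" "j + (i + sum_list zs) = d" using ys0 jd by auto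
      have "D (gap i j # zs) = 0"
      proof (cases "gap i j = 0")
        case True
        then show ?thesis using j z by (simp add: D0 lower)
      next
        case False
        have "gap i j < i + j" using z j by (auto simp: gap_def)
        then show ?thesis using False z by (intro lower) auto
      qed
      then show "real i * (D (gap i j # zs) - D ((i + j) # zs)) = real i * (- D ((i + j) # zs))"
        by simp
    qed
    finally have eq: "(real n - 1) * D (j # ys) = (\<Sum>l=1..<j. - D (l # (j - l) # ys))
       + del_sum ys (\<lambda>i zs. real i * (- D ((i + j) # zs)))" .
    have "\<bar>\<Sum>l=1..<j. - D (l # (j - l) # ys)\<bar> \<le> (\<Sum>l=1..<j. m)"
      by (rule order_trans[OF sum_abs sum_mono]) (use ys0 jd in \<open>auto intro!: le_m simp: L_def\<close>)
    moreover have "\<bar>del_sum ys (\<lambda>i zs. real i * (- D ((i + j) # zs)))\<bar> \<le> del_sum ys (\<lambda>i zs. m * real i)"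
    proof (rule del_sum_abs_le)
      fix i zs assume "mset ys = add_mset i (mset zs)"
      then have "set ys = insert i (set zs)" "sum_list ys = i + sum_list zs"
        by (rule set_of_deletion, rule sum_list_of_deletion)
      then have "(i + j) # zs \<in> L" using ys0 jd by (auto simp: L_def)
      from mult_left_mono[OF le_m[OF this], of "real i"]
      show "\<bar>real i * (- D ((i + j) # zs))\<bar> \<le> m * real i"
        by (simp add: abs_mult mult.commute)
    qed
    ultimately have "\<bar>(real n - 1) * D (j # ys)\<bar> \<le> real (j - 1) * m + m * real (sum_list ys)"
      unfolding eq del_sum_mult del_sum_real by simp
    also have "\<dots> = (real d - 1) * m"
      using j unfolding jd[symmetric] by (simp add: algebra_simps of_nat_diff)
    also have "\<bar>(real n - 1) * D (j # ys)\<bar> = (real n - 1) * m"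
      using zs Cons j less.prems by (simp add: abs_mult d_def)
    finally have "(real n - real d) * m \<le> 0" by (simp add: algebra_simps)
    then show ?thesis using less.prems by (simp add: mult_le_0_iff d_def)
  qed
  with le_m[OF xsL] show ?case by (simp add: D_def)
qed

section \<open>Plane rotations and powers of orthogonal matrices\<close>

lemma mult_mat_entry:
  assumes "A \<in> carrier_mat n n" "B \<in> carrier_mat n n" "i < n" "k < n"
  shows "(A * B) $$ (i, k) = (\<Sum>l<n. A $$ (i, l) * B $$ (l, k))"
  using assms by (auto simp: scalar_prod_def lessThan_atLeast0)

text \<open>
  The one-parameter group generated by \<open>E\<^sub>a\<^sub>b - E\<^sub>b\<^sub>a\<close>. For \<open>a = b\<close> the generator vanishes, and the group is
  trivial; sums may then run over all pairs of indices.
\<close>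

definition rot :: "nat \<Rightarrow> nat \<Rightarrow> nat \<Rightarrow> real \<Rightarrow> real mat" where
  "rot n a b t = mat n n (\<lambda>(i, k).
     if a = b then of_bool (i = k)
     else if i = a then of_bool (k = a) * cos t + of_bool (k = b) * sin t
     else if i = b then of_bool (k = b) * cos t - of_bool (k = a) * sin t
     else of_bool (i = k))"

lemma rot_carrier [simp]: "rot n a b t \<in> carrier_mat n n"
  by (simp add: rot_def)

lemma rot_dim [simp]: "dim_row (rot n a b t) = n" "dim_col (rot n a b t) = n"
  by (simp_all add: rot_def)

lemma rot_mult_entry:
  assumes "B \<in> carrier_mat n n" "a < n" "b < n" "i < n" "k < n"
  shows "(rot n a b t * B) $$ (i, k) =
    (if a = b then B $$ (i, k)
     else if i = a then cos t * B $$ (a, k) + sin t * B $$ (b, k)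
     else if i = b then cos t * B $$ (b, k) - sin t * B $$ (a, k)
     else B $$ (i, k))"
proof -
  have "(rot n a b t * B) $$ (i, k) = (\<Sum>l<n. rot n a b t $$ (i, l) * B $$ (l, k))"
    using assms by (intro mult_mat_entry) auto
  also have "\<dots> = (\<Sum>l<n. (if l = i then (if a = b \<or> i \<noteq> a \<and> i \<noteq> b then B $$ (i, k) else cos t * B $$ (i, k)) else 0)
      + (if l = b then (if a \<noteq> b \<and> i = a then sin t * B $$ (b, k) else 0) else 0)
      + (if l = a then (if a \<noteq> b \<and> i = b then - sin t * B $$ (a, k) else 0) else 0))"
    using assms by (intro sum.cong) (auto simp: rot_def)
  also have "\<dots> = (if a = b then B $$ (i, k)
     else if i = a then cos t * B $$ (a, k) + sin t * B $$ (b, k)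
     else if i = b then cos t * B $$ (b, k) - sin t * B $$ (a, k)
     else B $$ (i, k))"
    using assms by (simp add: sum.distrib)
  finally show ?thesis .
qed

lemma rot_mult:
  assumes "a < n" "b < n"
  shows "rot n a b s * rot n a b t = rot n a b (s + t)"
proof (rule eq_matI)
  fix i k assume "i < dim_row (rot n a b (s + t))" "k < dim_col (rot n a b (s + t))"
  then have "i < n" "k < n" by (simp_all add: rot_def)
  then show "(rot n a b s * rot n a b t) $$ (i, k) = rot n a b (s + t) $$ (i, k)"
    using assms unfolding rot_mult_entry[OF rot_carrier assms \<open>i < n\<close> \<open>k < n\<close>]
    by (auto simp: rot_def cos_add sin_add)
qed (simp_all add: rot_def)

lemma rot_0 [simp]: "rot n a b 0 = 1\<^sub>m n"
  by (rule eq_matI) (auto simp: rot_def)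

lemma rot_transpose: "transpose_mat (rot n a b t) = rot n a b (- t)"
  by (rule eq_matI) (auto simp: rot_def)

text \<open>
  An orthogonal matrix has determinant \<open>1\<close> or \<open>-1\<close>, and the rotation by \<open>t\<close> is the square of the rotation
  by \<open>t / 2\<close>.
\<close>

lemma rot_SO:
  assumes "a < n" "b < n"
  shows "rot n a b t \<in> SO n"
proof -
  have orth: "transpose_mat (rot n a b s) * rot n a b s = 1\<^sub>m n" for s
    using assms by (simp add: rot_transpose rot_mult)
  define D where "D = Determinant.det (rot n a b (t/2))"
  have "Determinant.det (transpose_mat (rot n a b (t/2)) * rot n a b (t/2)) = D * D"
    using Determinant.det_mult[of "transpose_mat (rot n a b (t/2))" n "rot n a b (t/2)"]
      Determinant.det_transpose[of "rot n a b (t/2)" n]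
    by (simp add: D_def)
  then have "D * D = 1" by (simp add: orth)
  moreover have "Determinant.det (rot n a b (t/2) * rot n a b (t/2)) = D * D"
    using Determinant.det_mult[of "rot n a b (t/2)" n "rot n a b (t/2)"] by (simp add: D_def)
  then have "Determinant.det (rot n a b t) = D * D"
    using rot_mult[OF assms, of "t/2" "t/2"] by simp
  ultimately show ?thesis by (simp add: SO_def orth)
qed

lemma one_SO: "1\<^sub>m n \<in> SO n"
  by (simp add: SO_def)

lemma pow_SO: "M \<in> SO n \<Longrightarrow> M ^\<^sub>m j \<in> SO n"
  using SO_carrier[of M n] by (induction j) (auto simp: one_SO SO_mult)

lemma SO_columns:
  assumes "A \<in> SO n" "i < n" "k < n"
  shows "(\<Sum>l<n. A $$ (l, i) * A $$ (l, k)) = of_bool (i = k)"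
proof -
  have A: "A \<in> carrier_mat n n" using assms by (simp add: SO_carrier)
  have "(transpose_mat A * A) $$ (i, k) = (\<Sum>l<n. A $$ (l, i) * A $$ (l, k))"
    using mult_mat_entry[of "transpose_mat A" n A i k] A assms by simp
  moreover have "(transpose_mat A * A) $$ (i, k) = of_bool (i = k)"
    using assms by (simp add: SO_def del: index_mult_mat(1))
  ultimately show ?thesis by simp
qed

lemma SO_entry_bound:
  assumes "A \<in> SO n" "i < n" "k < n"
  shows "\<bar>A $$ (i, k)\<bar> \<le> 1"
proof -
  have "A $$ (i, k) * A $$ (i, k) \<le> (\<Sum>l<n. A $$ (l, k) * A $$ (l, k))"
    using assms by (intro member_le_sum) auto
  also have "\<dots> = 1" using SO_columns[OF assms(1,3,3)] by simp
  finally show ?thesis using abs_le_square_iff[of "A $$ (i, k)" 1] by (simp add: power2_eq_square)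
qed

lemma pow_mat_add:
  assumes "(M :: real mat) \<in> carrier_mat n n"
  shows "M ^\<^sub>m (i + j) = M ^\<^sub>m i * M ^\<^sub>m j"
proof (induction j)
  case 0
  then show ?case using assms by simp
next
  case (Suc j)
  have "M ^\<^sub>m i * M ^\<^sub>m j * M = M ^\<^sub>m i * (M ^\<^sub>m j * M)"
    using assms by (intro assoc_mult_mat) auto
  then show ?case using Suc by simp
qed

definition tr_pow :: "nat \<Rightarrow> real mat \<Rightarrow> real" where
  "tr_pow j M = mat_trace (M ^\<^sub>m j)"

lemma tr_pow_eq: "M \<in> carrier_mat n n \<Longrightarrow> tr_pow j M = (\<Sum>c<n. (M ^\<^sub>m j) $$ (c, c))"
  by (simp add: tr_pow_def mat_trace_def)

lemma tr_pow_0: "M \<in> carrier_mat n n \<Longrightarrow> tr_pow 0 M = real n"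
  by (simp add: tr_pow_def mat_trace_def)

lemma sum_entries_transposed:
  assumes "M \<in> carrier_mat n n"
  shows "(\<Sum>a<n. \<Sum>b<n. (M ^\<^sub>m i) $$ (b, a) * (M ^\<^sub>m j) $$ (a, b)) = tr_pow (i + j) M"
proof -
  have "tr_pow (i + j) M = (\<Sum>b<n. \<Sum>a<n. (M ^\<^sub>m i) $$ (b, a) * (M ^\<^sub>m j) $$ (a, b))"
    unfolding tr_pow_eq[OF assms] pow_mat_add[OF assms]
    using assms by (intro sum.cong mult_mat_entry) auto
  also have "\<dots> = (\<Sum>a<n. \<Sum>b<n. (M ^\<^sub>m i) $$ (b, a) * (M ^\<^sub>m j) $$ (a, b))"
    by (rule sum.swap)
  finally show ?thesis ..
qed

text \<open>
  This is where orthogonality turns \<open>M\<^sup>T\<close> into the inverse: the sum is the trace of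
  \<open>(M\<^sup>i)\<^sup>T M\<^bsup>i+k\<^esup> = M\<^sup>k\<close>.
\<close>

lemma sum_entries_le:
  assumes M: "M \<in> SO n"
  shows "(\<Sum>a<n. \<Sum>b<n. (M ^\<^sub>m i) $$ (a, b) * (M ^\<^sub>m (i + k)) $$ (a, b)) = tr_pow k M"
proof -
  have c: "M \<in> carrier_mat n n" using M by (rule SO_carrier)
  have "(\<Sum>a<n. \<Sum>b<n. (M ^\<^sub>m i) $$ (a, b) * (M ^\<^sub>m (i + k)) $$ (a, b))
     = (\<Sum>a<n. \<Sum>b<n. \<Sum>l<n. (M ^\<^sub>m i) $$ (a, b) * (M ^\<^sub>m i) $$ (a, l) * (M ^\<^sub>m k) $$ (l, b))"
    unfolding pow_mat_add[OF c] using c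
    by (intro sum.cong refl) (simp add: mult_mat_entry[of _ n] sum_distrib_left mult.assoc del: index_mult_mat(1))
  also have "\<dots> = (\<Sum>b<n. \<Sum>l<n. \<Sum>a<n. (M ^\<^sub>m i) $$ (a, b) * (M ^\<^sub>m i) $$ (a, l) * (M ^\<^sub>m k) $$ (l, b))"
    by (subst sum.swap, rule sum.cong[OF refl], subst sum.swap) simp
  also have "\<dots> = (\<Sum>b<n. \<Sum>l<n. of_bool (b = l) * (M ^\<^sub>m k) $$ (l, b))"
    unfolding sum_distrib_right[symmetric]
    by (intro sum.cong refl) (simp add: SO_columns[OF pow_SO[OF M]])
  also have "\<dots> = tr_pow k M"
    unfolding tr_pow_eq[OF c] by (intro sum.cong refl) simp
  finally show ?thesis .
qed

lemma sum_entries: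
  assumes M: "M \<in> SO n"
  shows "(\<Sum>a<n. \<Sum>b<n. (M ^\<^sub>m i) $$ (a, b) * (M ^\<^sub>m j) $$ (a, b)) = tr_pow (gap i j) M"
proof (cases "i \<le> j")
  case True
  then show ?thesis using sum_entries_le[OF M, of i "j - i"] by (simp add: gap_def)
next
  case False
  then show ?thesis using sum_entries_le[OF M, of j "i - j"] by (simp add: gap_def mult.commute)
qed

text \<open>
  Product rule for \<open>M\<^sup>j\<close> in the direction \<open>X M\<close> with \<open>X = E\<^sub>a\<^sub>b - E\<^sub>b\<^sub>a\<close>: the sum of \<open>M\<^sup>l X M\<^bsup>j-l\<^esup>\<close>.
\<close>

lemma pow_entry_deriv:
  assumes M: "M \<in> carrier_mat n n" and ab: "a < n" "b < n" and cd: "c < n" "d < n"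
  shows "((\<lambda>t. ((rot n a b t * M) ^\<^sub>m j) $$ (c, d)) has_real_derivative
     (\<Sum>l<j. (M ^\<^sub>m l) $$ (c, a) * (M ^\<^sub>m (j - l)) $$ (b, d)
           - (M ^\<^sub>m l) $$ (c, b) * (M ^\<^sub>m (j - l)) $$ (a, d))) (at 0)"
  using cd
proof (induction j arbitrary: d)
  case 0
  then show ?case using M by simp
next
  case (Suc j)
  let ?R = "\<lambda>t. rot n a b t * M"
  have R: "?R t \<in> carrier_mat n n" for t by (rule mult_carrier_mat[OF rot_carrier M])
  have R0: "?R 0 = M" using M by simp
  have entry: "((\<lambda>t. ?R t $$ (k, d)) has_real_derivative
      of_bool (k = a) * M $$ (b, d) - of_bool (k = b) * M $$ (a, d)) (at 0)" if "k < n" for k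
    unfolding rot_mult_entry[OF M ab that \<open>d < n\<close>]
    by (cases "a = b"; cases "k = a"; cases "k = b") (auto intro!: derivative_eq_intros)
  have "((\<lambda>t. \<Sum>k<n. (?R t ^\<^sub>m j) $$ (c, k) * ?R t $$ (k, d)) has_real_derivative
     (\<Sum>k<n. (\<Sum>l<j. (M ^\<^sub>m l) $$ (c, a) * (M ^\<^sub>m (j - l)) $$ (b, k)
           - (M ^\<^sub>m l) $$ (c, b) * (M ^\<^sub>m (j - l)) $$ (a, k)) * ?R 0 $$ (k, d)
         + (of_bool (k = a) * M $$ (b, d) - of_bool (k = b) * M $$ (a, d)) * (?R 0 ^\<^sub>m j) $$ (c, k))) (at 0)"
    by (intro DERIV_sum DERIV_mult Suc.IH entry) (use Suc.prems in auto)
  moreover have "(\<lambda>t. \<Sum>k<n. (?R t ^\<^sub>m j) $$ (c, k) * ?R t $$ (k, d))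
      = (\<lambda>t. (?R t ^\<^sub>m Suc j) $$ (c, d))"
    using Suc.prems R by (simp add: mult_mat_entry[of _ n] del: index_mult_mat(1))
  moreover have "(\<Sum>k<n. (\<Sum>l<j. (M ^\<^sub>m l) $$ (c, a) * (M ^\<^sub>m (j - l)) $$ (b, k)
           - (M ^\<^sub>m l) $$ (c, b) * (M ^\<^sub>m (j - l)) $$ (a, k)) * ?R 0 $$ (k, d)
         + (of_bool (k = a) * M $$ (b, d) - of_bool (k = b) * M $$ (a, d)) * (?R 0 ^\<^sub>m j) $$ (c, k))
      = (\<Sum>l<Suc j. (M ^\<^sub>m l) $$ (c, a) * (M ^\<^sub>m (Suc j - l)) $$ (b, d)
           - (M ^\<^sub>m l) $$ (c, b) * (M ^\<^sub>m (Suc j - l)) $$ (a, d))" (is "?L = ?Rr")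
  proof -
    have pw: "(\<Sum>k<n. (M ^\<^sub>m (j - l)) $$ (e, k) * M $$ (k, d)) = (M ^\<^sub>m (Suc j - l)) $$ (e, d)"
      if "l < j" "e < n" for l e
      using that Suc.prems M by (simp add: Suc_diff_le mult_mat_entry[of _ n] del: index_mult_mat(1))
    have "?L = (\<Sum>k<n. \<Sum>l<j. (M ^\<^sub>m l) $$ (c, a) * ((M ^\<^sub>m (j - l)) $$ (b, k) * M $$ (k, d))
           - (M ^\<^sub>m l) $$ (c, b) * ((M ^\<^sub>m (j - l)) $$ (a, k) * M $$ (k, d)))
        + (\<Sum>k<n. of_bool (k = a) * (M $$ (b, d) * (M ^\<^sub>m j) $$ (c, a))
              - of_bool (k = b) * (M $$ (a, d) * (M ^\<^sub>m j) $$ (c, b)))"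
      unfolding R0 sum.distrib[symmetric] sum_distrib_right
      by (intro sum.cong arg_cong2[where f = "(+)"] refl) (auto simp: algebra_simps)
    also have "\<dots> = (\<Sum>l<j. (M ^\<^sub>m l) $$ (c, a) * (M ^\<^sub>m (Suc j - l)) $$ (b, d)
           - (M ^\<^sub>m l) $$ (c, b) * (M ^\<^sub>m (Suc j - l)) $$ (a, d))
        + (M $$ (b, d) * (M ^\<^sub>m j) $$ (c, a) - M $$ (a, d) * (M ^\<^sub>m j) $$ (c, b))"
      using ab by (subst sum.swap)
        (simp add: sum_subtractf sum_distrib_left[symmetric] pw)
    also have "\<dots> = ?Rr" using M ab Suc.prems by (simp add: mult.commute)
    finally show ?thesis .
  qed
  ultimately show ?case by simp
qed

text \<open>
  The trace of \<open>X M\<^sup>j\<close> for \<open>X = E\<^sub>a\<^sub>b - E\<^sub>b\<^sub>a\<close>, that is, the derivative of \<open>p\<^sub>j\<close> divided by \<open>j\<close>.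
\<close>

definition skew :: "nat \<Rightarrow> nat \<Rightarrow> nat \<Rightarrow> real mat \<Rightarrow> real" where
  "skew j a b M = (M ^\<^sub>m j) $$ (b, a) - (M ^\<^sub>m j) $$ (a, b)"

lemma tr_pow_deriv:
  assumes M: "M \<in> carrier_mat n n" and ab: "a < n" "b < n"
  shows "((\<lambda>t. tr_pow j (rot n a b t * M)) has_real_derivative real j * skew j a b M) (at 0)"
proof -
  have R: "rot n a b t * M \<in> carrier_mat n n" for t by (rule mult_carrier_mat[OF rot_carrier M])
  have prod: "(\<Sum>c<n. (M ^\<^sub>m l) $$ (c, e) * (M ^\<^sub>m (j - l)) $$ (f, c)) = (M ^\<^sub>m j) $$ (f, e)"
    if "l < j" "e < n" "f < n" for l e f
  proof -
    have "(M ^\<^sub>m j) $$ (f, e) = (M ^\<^sub>m (j - l) * M ^\<^sub>m l) $$ (f, e)"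
      using pow_mat_add[OF M, of "j - l" l] that by simp
    also have "\<dots> = (\<Sum>c<n. (M ^\<^sub>m (j - l)) $$ (f, c) * (M ^\<^sub>m l) $$ (c, e))"
      using M that by (intro mult_mat_entry) auto
    finally show ?thesis by (simp add: mult.commute)
  qed
  have "((\<lambda>t. \<Sum>c<n. ((rot n a b t * M) ^\<^sub>m j) $$ (c, c)) has_real_derivative
     (\<Sum>c<n. \<Sum>l<j. (M ^\<^sub>m l) $$ (c, a) * (M ^\<^sub>m (j - l)) $$ (b, c)
           - (M ^\<^sub>m l) $$ (c, b) * (M ^\<^sub>m (j - l)) $$ (a, c))) (at 0)"
    using M ab by (intro DERIV_sum pow_entry_deriv) auto
  moreover have "(\<Sum>c<n. \<Sum>l<j. (M ^\<^sub>m l) $$ (c, a) * (M ^\<^sub>m (j - l)) $$ (b, c)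
           - (M ^\<^sub>m l) $$ (c, b) * (M ^\<^sub>m (j - l)) $$ (a, c)) = real j * skew j a b M"
    using ab by (subst sum.swap) (simp add: sum_subtractf prod skew_def)
  ultimately show ?thesis by (simp add: tr_pow_eq[OF R])
qed

text \<open>
  The carre du champ of two power sums, up to the factor \<open>i j\<close>. The factor \<open>2\<close> is there because each
  plane is counted once for \<open>(a, b)\<close> and once for \<open>(b, a)\<close>.
\<close>

lemma sum_skew_skew:
  assumes M: "M \<in> SO n"
  shows "(\<Sum>a<n. \<Sum>b<n. skew i a b M * skew j a b M) = 2 * (tr_pow (gap i j) M - tr_pow (i + j) M)"
proof -
  have c: "M \<in> carrier_mat n n" using M by (rule SO_carrier)
  have s: "(\<Sum>a<n. \<Sum>b<n. f b a) = (\<Sum>a<n. \<Sum>b<n. f a b)" for f :: "nat \<Rightarrow> nat \<Rightarrow> real"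
    by (rule sum.swap)
  have "(\<Sum>a<n. \<Sum>b<n. skew i a b M * skew j a b M)
     = (\<Sum>a<n. \<Sum>b<n. (M ^\<^sub>m i) $$ (b, a) * (M ^\<^sub>m j) $$ (b, a))
     + (\<Sum>a<n. \<Sum>b<n. (M ^\<^sub>m i) $$ (a, b) * (M ^\<^sub>m j) $$ (a, b))
     - (\<Sum>a<n. \<Sum>b<n. (M ^\<^sub>m i) $$ (b, a) * (M ^\<^sub>m j) $$ (a, b))
     - (\<Sum>a<n. \<Sum>b<n. (M ^\<^sub>m i) $$ (a, b) * (M ^\<^sub>m j) $$ (b, a))"
    by (simp add: skew_def algebra_simps sum.distrib sum_subtractf)
  then show ?thesis
    unfolding s[of "\<lambda>a b. (M ^\<^sub>m i) $$ (a, b) * (M ^\<^sub>m j) $$ (a, b)"]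
      s[of "\<lambda>a b. (M ^\<^sub>m i) $$ (b, a) * (M ^\<^sub>m j) $$ (a, b)"]
      sum_entries[OF M] sum_entries_transposed[OF c]
    by simp
qed

section \<open>Integration by parts for the Haar measure\<close>

definition bdd_meas :: "nat \<Rightarrow> (real mat \<Rightarrow> real) \<Rightarrow> bool" where
  "bdd_meas n F \<longleftrightarrow> F \<in> borel_measurable (SO_borel n) \<and> (\<exists>B. \<forall>M\<in>SO n. \<bar>F M\<bar> \<le> B)"

lemma bdd_measI:
  assumes "F \<in> borel_measurable (SO_borel n)" "\<And>M. M \<in> SO n \<Longrightarrow> \<bar>F M\<bar> \<le> B"
  shows "bdd_meas n F"
  using assms by (auto simp: bdd_meas_def)

lemma bdd_meas_const: "bdd_meas n (\<lambda>M. c)"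
  by (rule bdd_measI[of _ _ "\<bar>c\<bar>"]) auto

lemma bdd_meas_add:
  assumes "bdd_meas n F" "bdd_meas n G"
  shows "bdd_meas n (\<lambda>M. F M + G M)"
proof -
  from assms obtain B C where "\<forall>M\<in>SO n. \<bar>F M\<bar> \<le> B" "\<forall>M\<in>SO n. \<bar>G M\<bar> \<le> C"
    by (auto simp: bdd_meas_def)
  then show ?thesis using assms
    by (intro bdd_measI[of _ _ "B + C"])
      (auto simp: bdd_meas_def intro!: order_trans[OF abs_triangle_ineq] add_mono)
qed

lemma bdd_meas_mult:
  assumes "bdd_meas n F" "bdd_meas n G"
  shows "bdd_meas n (\<lambda>M. F M * G M)"
proof -
  from assms obtain B C where "\<forall>M\<in>SO n. \<bar>F M\<bar> \<le> B" "\<forall>M\<in>SO n. \<bar>G M\<bar> \<le> C"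
    by (auto simp: bdd_meas_def)
  then show ?thesis using assms
    by (intro bdd_measI[of _ _ "B * C"])
      (auto simp: bdd_meas_def abs_mult intro!: mult_mono order_trans[OF abs_ge_zero])
qed

lemma bdd_meas_diff:
  assumes "bdd_meas n F" "bdd_meas n G"
  shows "bdd_meas n (\<lambda>M. F M - G M)"
  using bdd_meas_add[OF assms(1) bdd_meas_mult[OF bdd_meas_const[of n "-1"] assms(2)]] by simp

lemma bdd_meas_sum:
  assumes "\<And>i. i \<in> I \<Longrightarrow> bdd_meas n (F i)"
  shows "bdd_meas n (\<lambda>M. \<Sum>i\<in>I. F i M)"
  using assms
  by (induction I rule: infinite_finite_induct) (auto intro: bdd_meas_const bdd_meas_add)

lemma bdd_meas_del_sum:
  assumes "\<And>i ys. bdd_meas n (F i ys)"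
  shows "bdd_meas n (\<lambda>M. del_sum xs (\<lambda>i ys. F i ys M))"
  using assms
  by (induction xs arbitrary: F) (auto intro: bdd_meas_const bdd_meas_add)

lemma bdd_meas_pow_entry:
  assumes "c < n" "d < n"
  shows "bdd_meas n (\<lambda>M. (M ^\<^sub>m j) $$ (c, d))"
proof -
  have "(\<lambda>M. (M ^\<^sub>m j) $$ (c, d)) \<in> borel_measurable (SO_borel n)"
    using assms(2)
  proof (induction j arbitrary: d)
    case 0
    have "(\<lambda>M. (M ^\<^sub>m 0) $$ (c, d)) \<in> borel_measurable (SO_borel n) \<longleftrightarrow>
      (\<lambda>M. of_bool (c = d) :: real) \<in> borel_measurable (SO_borel n)"
      using assms(1) 0 by (intro measurable_cong) (auto dest!: SO_carrier)
    then show ?case by simp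
  next
    case (Suc j)
    have "(\<lambda>M. (M ^\<^sub>m Suc j) $$ (c, d)) \<in> borel_measurable (SO_borel n) \<longleftrightarrow>
      (\<lambda>M. \<Sum>l<n. (M ^\<^sub>m j) $$ (c, l) * M $$ (l, d)) \<in> borel_measurable (SO_borel n)"
      using assms(1) Suc.prems
      by (intro measurable_cong)
        (auto dest!: SO_carrier simp: mult_mat_entry[of _ n] simp del: index_mult_mat(1))
    also have "\<dots>"
      using Suc by (intro borel_measurable_sum borel_measurable_times measurable_SO_entry) auto
    finally show ?case .
  qed
  then show ?thesis
    using assms by (rule_tac bdd_measI[of _ _ 1]) (auto intro: SO_entry_bound pow_SO)
qed

lemma bdd_meas_skew: "a < n \<Longrightarrow> b < n \<Longrightarrow> bdd_meas n (skew j a b)"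
  unfolding skew_def by (intro bdd_meas_diff bdd_meas_pow_entry)

lemma bdd_meas_cong:
  assumes "\<And>M. M \<in> SO n \<Longrightarrow> F M = G M"
  shows "bdd_meas n F \<longleftrightarrow> bdd_meas n G"
proof -
  have "F \<in> borel_measurable (SO_borel n) \<longleftrightarrow> G \<in> borel_measurable (SO_borel n)"
    using assms by (intro measurable_cong) auto
  then show ?thesis using assms by (simp add: bdd_meas_def)
qed

lemma bdd_meas_tr_pow: "bdd_meas n (tr_pow j)"
proof -
  have "bdd_meas n (\<lambda>M. \<Sum>c<n. (M ^\<^sub>m j) $$ (c, c))"
    by (intro bdd_meas_sum bdd_meas_pow_entry) auto
  then show ?thesis
    by (subst bdd_meas_cong[where G = "\<lambda>M. \<Sum>c<n. (M ^\<^sub>m j) $$ (c, c)"])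
      (auto simp: tr_pow_eq dest: SO_carrier)
qed

text \<open>
  The class of functions that may be integrated by parts. Asking for the derivative at \<open>t = 0\<close> at every point
  of the group gives it at all \<open>t\<close>, by the group law of the rotations.
\<close>

definition rot_deriv :: "nat \<Rightarrow> (real mat \<Rightarrow> real) \<Rightarrow> (nat \<Rightarrow> nat \<Rightarrow> real mat \<Rightarrow> real) \<Rightarrow> bool" where
  "rot_deriv n F F' \<longleftrightarrow> bdd_meas n F \<and>
     (\<forall>a<n. \<forall>b<n. bdd_meas n (F' a b) \<and>
        (\<forall>M\<in>SO n. ((\<lambda>t. F (rot n a b t * M)) has_real_derivative F' a b M) (at 0)))"

lemma rot_deriv_const: "rot_deriv n (\<lambda>M. c) (\<lambda>a b M. 0)"
  by (simp add: rot_deriv_def bdd_meas_const)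

lemma rot_deriv_add:
  assumes "rot_deriv n F F'" "rot_deriv n G G'"
  shows "rot_deriv n (\<lambda>M. F M + G M) (\<lambda>a b M. F' a b M + G' a b M)"
  using assms by (auto simp: rot_deriv_def intro!: bdd_meas_add DERIV_add)

lemma rot_deriv_diff:
  assumes "rot_deriv n F F'" "rot_deriv n G G'"
  shows "rot_deriv n (\<lambda>M. F M - G M) (\<lambda>a b M. F' a b M - G' a b M)"
  using assms by (auto simp: rot_deriv_def intro!: bdd_meas_diff DERIV_diff)

lemma one_SO_mult: "M \<in> SO n \<Longrightarrow> 1\<^sub>m n * M = M"
  using SO_carrier[of M n] by simp

lemma rot_deriv_mult:
  assumes "rot_deriv n F F'" "rot_deriv n G G'"
  shows "rot_deriv n (\<lambda>M. F M * G M) (\<lambda>a b M. F' a b M * G M + G' a b M * F M)"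
  unfolding rot_deriv_def
proof (intro conjI allI impI ballI)
  fix a b M assume ab: "a < n" "b < n" and M: "M \<in> SO n"
  have "((\<lambda>t. F (rot n a b t * M) * G (rot n a b t * M)) has_real_derivative
    F' a b M * G (rot n a b 0 * M) + G' a b M * F (rot n a b 0 * M)) (at 0)"
    using assms ab M by (intro DERIV_mult) (auto simp: rot_deriv_def)
  then show "((\<lambda>t. F (rot n a b t * M) * G (rot n a b t * M)) has_real_derivative
    F' a b M * G M + G' a b M * F M) (at 0)"
    using M by (simp add: one_SO_mult)
qed (use assms in \<open>auto simp: rot_deriv_def intro!: bdd_meas_add bdd_meas_mult\<close>)

lemma rot_deriv_sum:
  assumes "\<And>i. i \<in> I \<Longrightarrow> rot_deriv n (F i) (F' i)"
  shows "rot_deriv n (\<lambda>M. \<Sum>i\<in>I. F i M) (\<lambda>a b M. \<Sum>i\<in>I. F' i a b M)"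
  using assms
  by (induction I rule: infinite_finite_induct) (auto intro: rot_deriv_const rot_deriv_add)

lemma rot_deriv_pow_entry:
  assumes "c < n" "d < n"
  shows "rot_deriv n (\<lambda>M. (M ^\<^sub>m j) $$ (c, d))
     (\<lambda>a b M. \<Sum>l<j. (M ^\<^sub>m l) $$ (c, a) * (M ^\<^sub>m (j - l)) $$ (b, d)
           - (M ^\<^sub>m l) $$ (c, b) * (M ^\<^sub>m (j - l)) $$ (a, d))"
  using assms
  by (auto simp: rot_deriv_def
      intro!: bdd_meas_sum bdd_meas_diff bdd_meas_mult bdd_meas_pow_entry pow_entry_deriv SO_carrier)

lemma rot_deriv_tr_pow: "rot_deriv n (tr_pow j) (\<lambda>a b M. real j * skew j a b M)"
  by (auto simp: rot_deriv_def
      intro!: bdd_meas_tr_pow bdd_meas_mult bdd_meas_const bdd_meas_skew tr_pow_deriv SO_carrier)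

lemma rot_deriv_compose:
  assumes F: "rot_deriv n F F'"
    and f: "\<And>x. (f has_real_derivative f' x) (at x)"
    and f': "f' \<in> borel_measurable borel"
    and bound: "\<And>x. \<bar>f x\<bar> \<le> K" "\<And>x. \<bar>f' x\<bar> \<le> K'"
  shows "rot_deriv n (\<lambda>M. f (F M)) (\<lambda>a b M. f' (F M) * F' a b M)"
proof -
  have "continuous_on UNIV f"
    using f by (intro continuous_at_imp_continuous_on ballI DERIV_isCont) auto
  then have fm: "f \<in> borel_measurable borel" by (rule borel_measurable_continuous_onI)
  have Fm: "F \<in> borel_measurable (SO_borel n)" using F by (simp add: rot_deriv_def bdd_meas_def)
  have "bdd_meas n (\<lambda>M. f (F M))" "bdd_meas n (\<lambda>M. f' (F M))"
    using measurable_compose[OF Fm fm] measurable_compose[OF Fm f'] bound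
    by (auto intro: bdd_measI)
  moreover have "((\<lambda>t. f (F (rot n a b t * M))) has_real_derivative f' (F M) * F' a b M) (at 0)"
    if "a < n" "b < n" "M \<in> SO n" for a b M
  proof -
    have "((\<lambda>t. F (rot n a b t * M)) has_real_derivative F' a b M) (at 0)"
      using F that by (simp add: rot_deriv_def)
    moreover have "(f has_real_derivative f' (F M)) (at (F (rot n a b 0 * M)))"
      using that f by (simp add: one_SO_mult)
    ultimately show ?thesis by (rule DERIV_chain2[rotated])
  qed
  ultimately show ?thesis using F by (auto simp: rot_deriv_def intro!: bdd_meas_mult)
qed

lemma add_neg_twice_mult: "x + (- 2 * s) * f = x - 2 * (f * (s :: real))"
  by simp

lemma sum_swap3:
  "(\<Sum>a\<in>A. \<Sum>b\<in>B. \<Sum>l\<in>L. f a b l) = (\<Sum>l\<in>L. \<Sum>a\<in>A. \<Sum>b\<in>B. f a b l)"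
proof -
  have "(\<Sum>a\<in>A. \<Sum>b\<in>B. \<Sum>l\<in>L. f a b l) = (\<Sum>a\<in>A. \<Sum>l\<in>L. \<Sum>b\<in>B. f a b l)"
    by (rule sum.cong[OF refl]) (rule sum.swap)
  also have "\<dots> = (\<Sum>l\<in>L. \<Sum>a\<in>A. \<Sum>b\<in>B. f a b l)"
    by (rule sum.swap)
  finally show ?thesis .
qed

locale haar =
  fixes n :: nat and \<mu> :: "real mat measure"
  assumes haar: "haar_prob_SO n \<mu>"
begin

sublocale prob_space \<mu>
  using haar by (simp add: haar_prob_SO_def)

lemma space_\<mu> [simp]: "space \<mu> = SO n"
  using haar by (simp add: haar_prob_SO_def)

lemma measurable_\<mu> [simp]: "borel_measurable \<mu> = borel_measurable (SO_borel n)"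
  using haar by (intro measurable_cong_sets) (simp_all add: haar_prob_SO_def)

lemma integrable_bdd:
  assumes "bdd_meas n F"
  shows "integrable \<mu> F"
proof -
  from assms obtain B where "\<forall>M\<in>SO n. \<bar>F M\<bar> \<le> B" by (auto simp: bdd_meas_def)
  then show ?thesis
    using assms by (intro integrable_const_bound[where B = B]) (auto simp: bdd_meas_def)
qed

lemma integral_translate:
  fixes F :: "real mat \<Rightarrow> real"
  assumes "A \<in> SO n" "F \<in> borel_measurable (SO_borel n)"
  shows "(\<integral>M. F (A * M) \<partial>\<mu>) = (\<integral>M. F M \<partial>\<mu>)"
proof -
  have s: "sets \<mu> = sets (SO_borel n)" using haar by (simp add: haar_prob_SO_def)
  have "(\<lambda>B. A * B) \<in> measurable \<mu> \<mu>"
    using measurable_SO_translate[OF assms(1)] by (simp cong: measurable_cong_sets add: s)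
  moreover have "distr \<mu> \<mu> (\<lambda>B. A * B) = \<mu>"
    using haar assms(1) by (simp add: haar_prob_SO_def)
  ultimately show ?thesis
    using integral_distr[of "\<lambda>B. A * B" \<mu> \<mu> F] assms(2) by simp
qed

text \<open>
  By invariance the difference quotients of \<open>F\<close> along a rotation have integral \<open>0\<close>. They converge to
  \<open>F'\<close>, and by the mean value theorem they are values of \<open>F'\<close>, hence dominated by its bound.
\<close>

lemma integral_rot_deriv:
  assumes F: "rot_deriv n F F'" and ab: "a < n" "b < n"
  shows "(\<integral>M. F' a b M \<partial>\<mu>) = 0"
proof -
  have Fb: "bdd_meas n F" and F'b: "bdd_meas n (F' a b)"
    using F ab by (auto simp: rot_deriv_def)
  obtain B where B: "\<And>M. M \<in> SO n \<Longrightarrow> \<bar>F' a b M\<bar> \<le> B"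
    using F'b by (auto simp: bdd_meas_def)
  have R: "rot n a b t * M \<in> SO n" if "M \<in> SO n" for t M
    using that ab by (intro SO_mult rot_SO)
  have deriv: "((\<lambda>t. F (rot n a b t * M)) has_real_derivative F' a b (rot n a b s * M)) (at s)"
    if M: "M \<in> SO n" for M s
  proof -
    have "((\<lambda>t. F (rot n a b t * (rot n a b s * M))) has_real_derivative F' a b (rot n a b s * M)) (at 0)"
      using F ab R[OF M] by (simp add: rot_deriv_def)
    moreover have "rot n a b t * (rot n a b s * M) = rot n a b (t + s) * M" for t
      using assoc_mult_mat[OF rot_carrier rot_carrier SO_carrier[OF M], of a b t a b s]
      by (simp add: rot_mult ab)
    ultimately have "((\<lambda>t. F (rot n a b (t + s) * M)) has_real_derivative F' a b (rot n a b s * M)) (at 0)"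
      by simp
    then show ?thesis
      using DERIV_shift[of "\<lambda>t. F (rot n a b t * M)" "F' a b (rot n a b s * M)" 0 s] by simp
  qed
  define q where "q = (\<lambda>k M. (F (rot n a b (inverse (real (Suc k))) * M) - F M) / inverse (real (Suc k)))"
  have mF: "(\<lambda>M. F (rot n a b t * M)) \<in> borel_measurable (SO_borel n)" for t
    using measurable_compose[OF measurable_SO_translate[OF rot_SO[OF ab]]] Fb
    by (auto simp: bdd_meas_def)
  have "(\<lambda>k. \<integral>M. q k M \<partial>\<mu>) \<longlonglongrightarrow> (\<integral>M. F' a b M \<partial>\<mu>)"
  proof (rule integral_dominated_convergence[where w = "\<lambda>_. B"])
    show "F' a b \<in> borel_measurable \<mu>" using F'b by (simp add: bdd_meas_def)
    show "q k \<in> borel_measurable \<mu>" for k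
      using mF Fb unfolding q_def
      by (auto simp: bdd_meas_def intro!: borel_measurable_divide borel_measurable_diff)
    show "AE M in \<mu>. (\<lambda>k. q k M) \<longlonglongrightarrow> F' a b M"
    proof (rule AE_I2)
      fix M assume "M \<in> space \<mu>"
      then have M: "M \<in> SO n" by simp
      have "((\<lambda>h. (F (rot n a b h * M) - F M) / h) \<longlongrightarrow> F' a b M) (at 0)"
        using deriv[OF M, of 0] M by (simp add: DERIV_def one_SO_mult)
      moreover have "filterlim (\<lambda>k. inverse (real (Suc k))) (at 0) sequentially"
        using LIMSEQ_inverse_real_of_nat by (auto simp: filterlim_at)
      ultimately show "(\<lambda>k. q k M) \<longlonglongrightarrow> F' a b M"
        unfolding q_def by (rule filterlim_compose)
    qed
    show "AE M in \<mu>. norm (q k M) \<le> B" for k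
    proof (rule AE_I2)
      fix M assume "M \<in> space \<mu>"
      then have M: "M \<in> SO n" by simp
      let ?h = "inverse (real (Suc k))"
      have "\<exists>z>0. z < ?h \<and> F (rot n a b ?h * M) - F (rot n a b 0 * M) = (?h - 0) * F' a b (rot n a b z * M)"
        by (rule MVT2) (auto intro!: deriv M)
      then obtain z where "F (rot n a b ?h * M) - F M = ?h * F' a b (rot n a b z * M)"
        using M by (auto simp: one_SO_mult)
      then have "q k M = F' a b (rot n a b z * M)" by (simp add: q_def)
      then show "norm (q k M) \<le> B" using B[OF R[OF M]] by simp
    qed
  qed simp
  moreover have "(\<integral>M. q k M \<partial>\<mu>) = 0" for k
  proof -
    let ?A = "rot n a b (inverse (real (Suc k)))"
    have "bdd_meas n (\<lambda>M. F (?A * M))"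
      using Fb mF R unfolding bdd_meas_def by blast
    then have "(\<integral>M. F (?A * M) - F M \<partial>\<mu>) = 0"
      using integral_translate[OF rot_SO[OF ab], of F] Fb
      by (subst Bochner_Integration.integral_diff) (simp_all add: integrable_bdd, simp add: bdd_meas_def)
    then show ?thesis by (simp add: q_def)
  qed
  ultimately show ?thesis by (simp add: LIMSEQ_const_iff)
qed

text \<open>
  The derivative of \<open>F * skew j a b\<close> in the plane \<open>(a, b)\<close> has integral \<open>0\<close>; sum over all \<open>(a, b)\<close>. The term in which
  \<open>skew j a b\<close> is differentiated is the Laplacian of \<open>p\<^sub>j\<close>, computed below as \<open>lap\<close>; its summand \<open>l = 0\<close>
  is \<open>p\<^sub>j - n p\<^sub>j\<close>.
\<close>

lemma schwinger_dyson:
  assumes F: "rot_deriv n F F'" and j: "j \<ge> 1"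
  shows "(\<integral>M. F M * ((real n - 1) * tr_pow j M
            + (\<Sum>l=1..<j. tr_pow l M * tr_pow (j - l) M - tr_pow (gap j (2*l)) M)) \<partial>\<mu>)
     = (\<integral>M. (\<Sum>a<n. \<Sum>b<n. F' a b M * skew j a b M) \<partial>\<mu>) / 2"
proof -
  \<comment> \<open>\<open>Y' a b a' b'\<close> is the derivative of \<open>skew j a b\<close> in the plane \<open>(a', b')\<close>; only the diagonal
    \<open>a' = a\<close>, \<open>b' = b\<close> enters the Laplacian.\<close>
  define Y' where "Y' = (\<lambda>a b a' b' (M :: real mat). (\<Sum>l<j. (M ^\<^sub>m l) $$ (b, a') * (M ^\<^sub>m (j - l)) $$ (b', a)
           - (M ^\<^sub>m l) $$ (b, b') * (M ^\<^sub>m (j - l)) $$ (a', a))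
       - (\<Sum>l<j. (M ^\<^sub>m l) $$ (a, a') * (M ^\<^sub>m (j - l)) $$ (b', b)
           - (M ^\<^sub>m l) $$ (a, b') * (M ^\<^sub>m (j - l)) $$ (a', b)))"
  have Y: "rot_deriv n (skew j a b) (Y' a b)" if "a < n" "b < n" for a b
    unfolding skew_def Y'_def by (intro rot_deriv_diff rot_deriv_pow_entry that)
  define H where "H = (\<lambda>a b M. F' a b M * skew j a b M + Y' a b a b M * F M)"
  have Hd: "rot_deriv n (\<lambda>M. F M * skew j a b M) (\<lambda>a' b' M. F' a' b' M * skew j a b M + Y' a b a' b' M * F M)"
    if "a < n" "b < n" for a b
    by (intro rot_deriv_mult F Y that)
  have H0: "(\<integral>M. H a b M \<partial>\<mu>) = 0" and Hb: "bdd_meas n (H a b)" if "a < n" "b < n" for a b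
    using integral_rot_deriv[OF Hd[OF that] that] Hd[OF that] that
    by (auto simp: H_def rot_deriv_def)
  have "(\<integral>M. (\<Sum>a<n. \<Sum>b<n. H a b M) \<partial>\<mu>) = (\<Sum>a<n. \<Sum>b<n. \<integral>M. H a b M \<partial>\<mu>)"
    by (subst Bochner_Integration.integral_sum; (intro sum.cong refl Bochner_Integration.integral_sum)?)
      (auto intro!: integrable_bdd bdd_meas_sum Hb)
  also have "\<dots> = 0" using H0 by simp
  finally have 0: "(\<integral>M. (\<Sum>a<n. \<Sum>b<n. H a b M) \<partial>\<mu>) = 0" .
  have lap: "(\<Sum>a<n. \<Sum>b<n. Y' a b a b M) = - 2 * ((real n - 1) * tr_pow j M
            + (\<Sum>l=1..<j. tr_pow l M * tr_pow (j - l) M - tr_pow (gap j (2*l)) M))"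
    if M: "M \<in> SO n" for M
  proof -
    have c: "M \<in> carrier_mat n n" using M by (rule SO_carrier)
    have pp': "(\<Sum>a<n. \<Sum>b<n. (M ^\<^sub>m l) $$ (a, a) * (M ^\<^sub>m (j - l)) $$ (b, b))
        = tr_pow l M * tr_pow (j - l) M" for l
      by (simp add: tr_pow_eq[OF c] sum_product)
    have pp: "(\<Sum>a<n. \<Sum>b<n. (M ^\<^sub>m l) $$ (b, b) * (M ^\<^sub>m (j - l)) $$ (a, a))
        = tr_pow l M * tr_pow (j - l) M" for l
      by (subst sum.swap) (rule pp')
    have g: "gap l (j - l) = gap j (2 * l)" if "l < j" for l
      using that by (auto simp: gap_def)
    have "(\<Sum>a<n. \<Sum>b<n. Y' a b a b M)
      = (\<Sum>l<j. (\<Sum>a<n. \<Sum>b<n. (M ^\<^sub>m l) $$ (b, a) * (M ^\<^sub>m (j - l)) $$ (b, a))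
           - (\<Sum>a<n. \<Sum>b<n. (M ^\<^sub>m l) $$ (b, b) * (M ^\<^sub>m (j - l)) $$ (a, a))
           - ((\<Sum>a<n. \<Sum>b<n. (M ^\<^sub>m l) $$ (a, a) * (M ^\<^sub>m (j - l)) $$ (b, b))
           - (\<Sum>a<n. \<Sum>b<n. (M ^\<^sub>m l) $$ (a, b) * (M ^\<^sub>m (j - l)) $$ (a, b))))"
      unfolding Y'_def sum_subtractf[symmetric] by (rule sum_swap3)
    also have "\<dots> = (\<Sum>l<j. 2 * (tr_pow (gap j (2*l)) M - tr_pow l M * tr_pow (j - l) M))"
    proof (rule sum.cong[OF refl])
      fix l assume "l \<in> {..<j}"
      moreover have "(\<Sum>a<n. \<Sum>b<n. (M ^\<^sub>m l) $$ (b, a) * (M ^\<^sub>m (j - l)) $$ (b, a))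
         = (\<Sum>a<n. \<Sum>b<n. (M ^\<^sub>m l) $$ (a, b) * (M ^\<^sub>m (j - l)) $$ (a, b))"
        by (rule sum.swap)
      ultimately show "(\<Sum>a<n. \<Sum>b<n. (M ^\<^sub>m l) $$ (b, a) * (M ^\<^sub>m (j - l)) $$ (b, a))
           - (\<Sum>a<n. \<Sum>b<n. (M ^\<^sub>m l) $$ (b, b) * (M ^\<^sub>m (j - l)) $$ (a, a))
           - ((\<Sum>a<n. \<Sum>b<n. (M ^\<^sub>m l) $$ (a, a) * (M ^\<^sub>m (j - l)) $$ (b, b))
           - (\<Sum>a<n. \<Sum>b<n. (M ^\<^sub>m l) $$ (a, b) * (M ^\<^sub>m (j - l)) $$ (a, b)))
           = 2 * (tr_pow (gap j (2*l)) M - tr_pow l M * tr_pow (j - l) M)"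
        by (simp add: pp pp' sum_entries[OF M] g)
    qed
    also have "{..<j} = insert 0 {1..<j}" using j by auto
    finally show ?thesis
      using j by (simp add: tr_pow_0[OF c] gap_def[of j 0] sum_subtractf sum_distrib_left[symmetric]
          algebra_simps)
  qed
  let ?S = "\<lambda>M. (real n - 1) * tr_pow j M
            + (\<Sum>l=1..<j. tr_pow l M * tr_pow (j - l) M - tr_pow (gap j (2*l)) M)"
  have "(\<integral>M. (\<Sum>a<n. \<Sum>b<n. H a b M) \<partial>\<mu>)
     = (\<integral>M. (\<Sum>a<n. \<Sum>b<n. F' a b M * skew j a b M) - 2 * (F M * ?S M) \<partial>\<mu>)"
  proof (rule Bochner_Integration.integral_cong[OF refl])
    fix M assume "M \<in> space \<mu>"
    then have "M \<in> SO n" by simp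
    have "(\<Sum>a<n. \<Sum>b<n. H a b M)
      = (\<Sum>a<n. \<Sum>b<n. F' a b M * skew j a b M) + (\<Sum>a<n. \<Sum>b<n. Y' a b a b M) * F M"
      by (simp add: H_def sum.distrib sum_distrib_right[symmetric])
    then show "(\<Sum>a<n. \<Sum>b<n. H a b M)
      = (\<Sum>a<n. \<Sum>b<n. F' a b M * skew j a b M) - 2 * (F M * ?S M)"
      unfolding lap[OF \<open>M \<in> SO n\<close>] by (rule trans) (rule add_neg_twice_mult)
  qed
  also have "\<dots> = (\<integral>M. (\<Sum>a<n. \<Sum>b<n. F' a b M * skew j a b M) \<partial>\<mu>) - 2 * (\<integral>M. F M * ?S M \<partial>\<mu>)"
  proof -
    have "bdd_meas n F" "\<And>a b. a < n \<Longrightarrow> b < n \<Longrightarrow> bdd_meas n (F' a b)"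
      using F by (auto simp: rot_deriv_def)
    then have "integrable \<mu> (\<lambda>M. \<Sum>a<n. \<Sum>b<n. F' a b M * skew j a b M)"
      "integrable \<mu> (\<lambda>M. 2 * (F M * ?S M))"
      by (auto intro!: integrable_bdd bdd_meas_sum bdd_meas_mult bdd_meas_add bdd_meas_diff
          bdd_meas_const bdd_meas_tr_pow bdd_meas_skew)
    then show ?thesis by (subst Bochner_Integration.integral_diff) auto
  qed
  finally show ?thesis using 0 by simp
qed

end

section \<open>Exact moments of traces in low degree\<close>

lemma sum_skew_square:
  assumes M: "M \<in> SO n"
  shows "(\<Sum>a<n. \<Sum>b<n. skew j a b M * skew j a b M) = 2 * (real n - tr_pow (2 * j) M)"
proof -
  have "gap j j = 0" "j + j = 2 * j" by (simp_all add: gap_def)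
  then show ?thesis using sum_skew_skew[OF M, of j j] by (simp only: tr_pow_0[OF SO_carrier[OF M]])
qed

definition monom_tr :: "nat list \<Rightarrow> real mat \<Rightarrow> real" where
  "monom_tr xs M = prod_list (map (\<lambda>j. tr_pow j M) xs)"

lemma monom_tr_simps [simp]:
  "monom_tr [] M = 1" "monom_tr (x # xs) M = tr_pow x M * monom_tr xs M"
  by (simp_all add: monom_tr_def)

lemma rot_deriv_monom:
  "rot_deriv n (monom_tr xs) (\<lambda>a b M. del_sum xs (\<lambda>i ys. real i * skew i a b M * monom_tr ys M))"
proof (induction xs)
  case Nil
  then show ?case using rot_deriv_const[of n 1] by (simp add: monom_tr_def[abs_def])
next
  case (Cons x xs)
  have "rot_deriv n (\<lambda>M. tr_pow x M * monom_tr xs M)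
    (\<lambda>a b M. real x * skew x a b M * monom_tr xs M
        + del_sum xs (\<lambda>i ys. real i * skew i a b M * monom_tr ys M) * tr_pow x M)"
    by (intro rot_deriv_mult rot_deriv_tr_pow Cons.IH)
  moreover have "del_sum xs (\<lambda>i ys. real i * skew i a b M * monom_tr ys M) * tr_pow x M
     = del_sum xs (\<lambda>i ys. real i * skew i a b M * monom_tr (x # ys) M)" for a b M
    unfolding mult.commute[of _ "tr_pow x M"] del_sum_mult[symmetric]
    by (rule del_sum_cong_mset) simp
  moreover have "monom_tr (x # xs) = (\<lambda>M. tr_pow x M * monom_tr xs M)"
    by (rule ext) simp
  ultimately show ?case by simp
qed

lemma bdd_meas_monom: "bdd_meas n (monom_tr xs)"
  using rot_deriv_monom by (auto simp: rot_deriv_def)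

lemmas bdd_meas_intros = bdd_meas_const bdd_meas_add bdd_meas_diff bdd_meas_mult bdd_meas_sum
  bdd_meas_tr_pow bdd_meas_monom

context haar
begin

lemma prob_SO [simp]: "prob (SO n) = 1"
  using prob_space by simp

definition mom :: "nat list \<Rightarrow> real" where
  "mom xs = (\<integral>M. monom_tr xs M \<partial>\<mu>)"

lemma integrable_monom [simp]: "integrable \<mu> (monom_tr xs)"
  by (intro integrable_bdd bdd_meas_monom)

lemma integral_del_sum:
  assumes "\<And>i ys. bdd_meas n (F i ys)"
  shows "(\<integral>M. del_sum xs (\<lambda>i ys. F i ys M) \<partial>\<mu>) = del_sum xs (\<lambda>i ys. \<integral>M. F i ys M \<partial>\<mu>)"
  using assms
proof (induction xs arbitrary: F)
  case (Cons x xs)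
  have "(\<integral>M. del_sum (x # xs) (\<lambda>i ys. F i ys M) \<partial>\<mu>)
     = (\<integral>M. F x xs M \<partial>\<mu>) + (\<integral>M. del_sum xs (\<lambda>i ys. F i (x # ys) M) \<partial>\<mu>)"
    using Cons.prems
    by (simp, subst Bochner_Integration.integral_add)
      (auto intro!: integrable_bdd bdd_meas_del_sum)
  then show ?case using Cons.IH[of "\<lambda>i ys. F i (x # ys)"] Cons.prems by simp
qed simp

lemma mom_schwinger_dyson:
  assumes j: "j \<ge> 1"
  shows "(real n - 1) * mom (j # xs)
     = (\<Sum>l=1..<j. mom (gap j (2*l) # xs) - mom (l # (j - l) # xs))
     + del_sum xs (\<lambda>i ys. real i * (mom (gap i j # ys) - mom ((i + j) # ys)))"
proof -
  have "(\<integral>M. monom_tr xs M * ((real n - 1) * tr_pow j M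
            + (\<Sum>l=1..<j. tr_pow l M * tr_pow (j - l) M - tr_pow (gap j (2*l)) M)) \<partial>\<mu>)
     = (\<integral>M. (real n - 1) * monom_tr (j # xs) M
         + (\<Sum>l=1..<j. monom_tr (l # (j - l) # xs) M - monom_tr (gap j (2*l) # xs) M) \<partial>\<mu>)"
    by (intro Bochner_Integration.integral_cong refl)
      (simp add: algebra_simps sum_distrib_left sum_distrib_right)
  also have "\<dots> = (real n - 1) * mom (j # xs)
      + (\<Sum>l=1..<j. mom (l # (j - l) # xs) - mom (gap j (2*l) # xs))"
    unfolding mom_def
    by (simp del: monom_tr_simps)
  finally have lhs: "(\<integral>M. monom_tr xs M * ((real n - 1) * tr_pow j M
            + (\<Sum>l=1..<j. tr_pow l M * tr_pow (j - l) M - tr_pow (gap j (2*l)) M)) \<partial>\<mu>)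
     = (real n - 1) * mom (j # xs)
      + (\<Sum>l=1..<j. mom (l # (j - l) # xs) - mom (gap j (2*l) # xs))" .
  have "(\<integral>M. (\<Sum>a<n. \<Sum>b<n. del_sum xs (\<lambda>i ys. real i * skew i a b M * monom_tr ys M) * skew j a b M) \<partial>\<mu>)
    = (\<integral>M. del_sum xs (\<lambda>i ys. 2 * (real i * (monom_tr (gap i j # ys) M - monom_tr ((i + j) # ys) M))) \<partial>\<mu>)"
  proof (rule Bochner_Integration.integral_cong[OF refl])
    fix M assume "M \<in> space \<mu>"
    then have M: "M \<in> SO n" by simp
    have "(\<Sum>a<n. \<Sum>b<n. del_sum xs (\<lambda>i ys. real i * skew i a b M * monom_tr ys M) * skew j a b M)
      = del_sum xs (\<lambda>i ys. \<Sum>a<n. \<Sum>b<n. skew j a b M * (real i * skew i a b M * monom_tr ys M))"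
      unfolding del_sum_sum del_sum_mult by (simp add: mult.commute)
    also have "\<dots> = del_sum xs (\<lambda>i ys. 2 * (real i * (monom_tr (gap i j # ys) M - monom_tr ((i + j) # ys) M)))"
    proof (rule del_sum_cong_mset)
      fix i ys
      have "(\<Sum>a<n. \<Sum>b<n. skew j a b M * (real i * skew i a b M * monom_tr ys M))
        = real i * monom_tr ys M * (\<Sum>a<n. \<Sum>b<n. skew i a b M * skew j a b M)"
        by (simp add: sum_distrib_left mult_ac)
      then show "(\<Sum>a<n. \<Sum>b<n. skew j a b M * (real i * skew i a b M * monom_tr ys M))
        = 2 * (real i * (monom_tr (gap i j # ys) M - monom_tr ((i + j) # ys) M))"
        unfolding sum_skew_skew[OF M] by (simp add: algebra_simps)
    qed
    finally show "(\<Sum>a<n. \<Sum>b<n. del_sum xs (\<lambda>i ys. real i * skew i a b M * monom_tr ys M) * skew j a b M)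
      = del_sum xs (\<lambda>i ys. 2 * (real i * (monom_tr (gap i j # ys) M - monom_tr ((i + j) # ys) M)))" .
  qed
  also have "\<dots> = del_sum xs (\<lambda>i ys. 2 * (real i * (mom (gap i j # ys) - mom ((i + j) # ys))))"
    by (subst integral_del_sum)
      (auto intro!: bdd_meas_intros simp: mom_def simp del: monom_tr_simps)
  also have "\<dots> = 2 * del_sum xs (\<lambda>i ys. real i * (mom (gap i j # ys) - mom ((i + j) # ys)))"
    by (rule del_sum_mult)
  finally have rhs: "(\<integral>M. (\<Sum>a<n. \<Sum>b<n. del_sum xs (\<lambda>i ys. real i * skew i a b M * monom_tr ys M) * skew j a b M) \<partial>\<mu>)
    = 2 * del_sum xs (\<lambda>i ys. real i * (mom (gap i j # ys) - mom ((i + j) # ys)))" .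
  show ?thesis
    using schwinger_dyson[OF rot_deriv_monom[of n xs] j] unfolding lhs rhs
    by (simp add: sum_subtractf)
qed

text \<open>
  In degree below \<open>n\<close> the traces of powers have exactly the moments of independent Gaussians.
\<close>

theorem mom_eq_gmom:
  assumes "0 \<notin> set xs" "sum_list xs < n"
  shows "mom xs = gmom n xs"
proof (rule schwinger_dyson_unique[OF _ _ mom_schwinger_dyson assms])
  show "mom [] = 1" by (simp add: mom_def prob_space)
  show "mom (0 # ys) = real n * mom ys" for ys
  proof -
    have "mom (0 # ys) = (\<integral>M. real n * monom_tr ys M \<partial>\<mu>)"
      unfolding mom_def
      by (intro Bochner_Integration.integral_cong refl) (simp add: tr_pow_0[OF SO_carrier])
    then show ?thesis by (simp add: mom_def)
  qed
qed

lemma expectation_tr_pow: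
  assumes "k \<ge> 1" "k < n"
  shows "(\<integral>M. tr_pow k M \<partial>\<mu>) = mean_pow n k"
  using mom_eq_gmom[of "[k]"] assms by (simp add: mom_def)

lemma expectation_tr_pow_mult:
  assumes "a \<ge> 1" "b \<ge> 1" "a + b < n"
  shows "(\<integral>M. tr_pow a M * tr_pow b M \<partial>\<mu>)
     = mean_pow n a * mean_pow n b + (if a = b then real a else 0)"
  using mom_eq_gmom[of "[a, b]"] assms by (auto simp: mom_def)

lemma integrable_tr_pow [simp]: "integrable \<mu> (tr_pow k)"
  by (intro integrable_bdd bdd_meas_tr_pow)

lemma integrable_tr_pow_mult [simp]: "integrable \<mu> (\<lambda>M. tr_pow a M * tr_pow b M)"
  by (intro integrable_bdd bdd_meas_intros)

section \<open>The defect of the Stein equation\<close>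

definition centred :: "nat \<Rightarrow> real mat \<Rightarrow> real" where
  "centred j M = tr_pow j M - mean_pow n j"

text \<open>
  What is left of \<open>-1/j\<close> times the Laplacian of \<open>p\<^sub>j\<close> after subtracting \<open>(n - 1) * centred j\<close>. The first
  summand moves the mean of \<open>p\<^sub>j\<close> over, and cancels most of the \<open>-n\<close> coming from \<open>l = j / 2\<close>.
\<close>

definition defect :: "nat \<Rightarrow> real mat \<Rightarrow> real" where
  "defect j M = (real n - 1) * mean_pow n j
     + (\<Sum>l=1..<j. tr_pow l M * tr_pow (j - l) M - tr_pow (gap j (2*l)) M)"

lemma bdd_meas_centred: "bdd_meas n (centred j)"
  unfolding centred_def by (intro bdd_meas_intros)

lemma bdd_meas_defect: "bdd_meas n (defect j)"
  unfolding defect_def by (intro bdd_meas_intros)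

lemma schwinger_dyson_centred:
  assumes "rot_deriv n F F'" "j \<ge> 1"
  shows "(\<integral>M. F M * ((real n - 1) * centred j M + defect j M) \<partial>\<mu>)
     = (\<integral>M. (\<Sum>a<n. \<Sum>b<n. F' a b M * skew j a b M) \<partial>\<mu>) / 2"
  unfolding schwinger_dyson[OF assms, symmetric]
  by (simp add: centred_def defect_def algebra_simps)

lemma variance_tr_pow:
  assumes "j \<ge> 1" "2 * j < n"
  shows "(\<integral>M. centred j M * centred j M \<partial>\<mu>) = real j"
proof -
  have "(\<integral>M. centred j M * centred j M \<partial>\<mu>)
     = (\<integral>M. tr_pow j M * tr_pow j M - 2 * mean_pow n j * tr_pow j M + mean_pow n j * mean_pow n j \<partial>\<mu>)"
    by (simp add: centred_def algebra_simps)
  also have "\<dots> = real j"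
    using assms by (simp add: expectation_tr_pow expectation_tr_pow_mult prob_space)
  finally show ?thesis .
qed

text \<open>
  Take \<open>F = centred j\<close>. The right-hand side is \<open>j (n - E p\<^bsub>2j\<^esub>) = j (n - 1)\<close>, which \<open>(n - 1) E [q\<^sup>2]\<close>
  already accounts for. Exact moments are essential here: an error in \<open>E [q\<^sup>2]\<close> would be multiplied by \<open>n\<close>.
\<close>

lemma centred_defect_orthogonal:
  assumes j: "j \<ge> 1" "2 * j < n"
  shows "(\<integral>M. centred j M * defect j M \<partial>\<mu>) = 0"
proof -
  have d: "rot_deriv n (centred j) (\<lambda>a b M. real j * skew j a b M)"
    using rot_deriv_diff[OF rot_deriv_tr_pow[of n j] rot_deriv_const[of n "mean_pow n j"]]
    by (simp add: centred_def[abs_def])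
  have "(\<integral>M. (\<Sum>a<n. \<Sum>b<n. real j * skew j a b M * skew j a b M) \<partial>\<mu>)
     = (\<integral>M. 2 * real j * (real n - tr_pow (2 * j) M) \<partial>\<mu>)"
  proof (rule Bochner_Integration.integral_cong[OF refl])
    fix M assume "M \<in> space \<mu>"
    then have M: "M \<in> SO n" by simp
    have "(\<Sum>a<n. \<Sum>b<n. real j * skew j a b M * skew j a b M)
      = real j * (\<Sum>a<n. \<Sum>b<n. skew j a b M * skew j a b M)"
      by (simp add: sum_distrib_left mult_ac)
    then show "(\<Sum>a<n. \<Sum>b<n. real j * skew j a b M * skew j a b M)
      = 2 * real j * (real n - tr_pow (2 * j) M)"
      by (simp only: sum_skew_square[OF M] mult_ac)
  qed
  also have "\<dots> = 2 * real j * (real n - 1)"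
    using j by (simp add: expectation_tr_pow prob_space mean_pow_def)
  finally have "(\<integral>M. centred j M * ((real n - 1) * centred j M + defect j M) \<partial>\<mu>) = real j * (real n - 1)"
    using schwinger_dyson_centred[OF d j(1)] by simp
  moreover have "(\<integral>M. centred j M * ((real n - 1) * centred j M + defect j M) \<partial>\<mu>)
    = (real n - 1) * (\<integral>M. centred j M * centred j M \<partial>\<mu>) + (\<integral>M. centred j M * defect j M \<partial>\<mu>)"
  proof -
    have "(\<integral>M. centred j M * ((real n - 1) * centred j M + defect j M) \<partial>\<mu>)
      = (\<integral>M. (real n - 1) * (centred j M * centred j M) + centred j M * defect j M \<partial>\<mu>)"
      by (simp add: algebra_simps)
    also have "\<dots> = (real n - 1) * (\<integral>M. centred j M * centred j M \<partial>\<mu>) + (\<integral>M. centred j M * defect j M \<partial>\<mu>)"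
      by (subst Bochner_Integration.integral_add)
        (auto intro!: integrable_bdd bdd_meas_intros bdd_meas_centred bdd_meas_defect)
    finally show ?thesis .
  qed
  ultimately show ?thesis by (simp add: variance_tr_pow[OF j])
qed

text \<open>
  With \<open>F = defect j\<close>, orthogonality leaves \<open>E [S\<^sup>2]\<close> as the expectation of a carre du champ. That
  is a sum of fewer than \<open>j\<close> terms, each of which is a combination of first and second moments
  bounded by \<open>3 j\<^sup>2\<close>. A direct expansion of \<open>S\<^sup>2\<close> would involve fourth moments.
\<close>

lemma expectation_defect_square:
  assumes j: "j \<ge> 1" "2 * j < n"
  shows "(\<integral>M. defect j M * defect j M \<partial>\<mu>) \<le> 3 * real j ^ 3"
proof -
  let ?g = "\<lambda>l. gap j (2*l)"
  define D where "D = (\<lambda>a b M. \<Sum>l=1..<j. (real l * skew l a b M * tr_pow (j - l) M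
      + real (j - l) * skew (j - l) a b M * tr_pow l M) - real (?g l) * skew (?g l) a b M)"
  have d: "rot_deriv n (defect j) D"
  proof -
    have "rot_deriv n (\<lambda>M. (real n - 1) * mean_pow n j
       + (\<Sum>l=1..<j. tr_pow l M * tr_pow (j - l) M - tr_pow (?g l) M))
      (\<lambda>a b M. 0 + (\<Sum>l=1..<j. (real l * skew l a b M * tr_pow (j - l) M
      + real (j - l) * skew (j - l) a b M * tr_pow l M) - real (?g l) * skew (?g l) a b M))"
      by (intro rot_deriv_add rot_deriv_const rot_deriv_sum rot_deriv_diff rot_deriv_mult rot_deriv_tr_pow)
    then show ?thesis by (simp only: defect_def[abs_def] D_def add_0_left)
  qed
  \<comment> \<open>The \<open>l\<close>-th summand of \<open>\<Gamma>(S, p\<^sub>j) / j\<close>.\<close>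
  define T where "T = (\<lambda>l M.
      real l * (tr_pow (j - l) M * tr_pow (j - l) M - tr_pow (j - l) M * tr_pow (l + j) M)
    + real (j - l) * (tr_pow l M * tr_pow l M - tr_pow l M * tr_pow ((j - l) + j) M)
    - real (?g l) * (tr_pow (gap (?g l) j) M - tr_pow (?g l + j) M))"
  have "(\<integral>M. (\<Sum>a<n. \<Sum>b<n. D a b M * skew j a b M) \<partial>\<mu>) = (\<integral>M. 2 * (\<Sum>l=1..<j. T l M) \<partial>\<mu>)"
  proof (rule Bochner_Integration.integral_cong[OF refl])
    fix M assume "M \<in> space \<mu>"
    then have M: "M \<in> SO n" by simp
    have "(\<Sum>a<n. \<Sum>b<n. D a b M * skew j a b M)
      = (\<Sum>l=1..<j. \<Sum>a<n. \<Sum>b<n. real l * tr_pow (j - l) M * (skew l a b M * skew j a b M)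
         + real (j - l) * tr_pow l M * (skew (j - l) a b M * skew j a b M)
         - real (?g l) * (skew (?g l) a b M * skew j a b M))"
    proof -
      have "(\<Sum>a<n. \<Sum>b<n. D a b M * skew j a b M)
        = (\<Sum>a<n. \<Sum>b<n. \<Sum>l=1..<j. real l * tr_pow (j - l) M * (skew l a b M * skew j a b M)
         + real (j - l) * tr_pow l M * (skew (j - l) a b M * skew j a b M)
         - real (?g l) * (skew (?g l) a b M * skew j a b M))"
        unfolding D_def sum_distrib_right by (intro sum.cong refl) (simp add: algebra_simps)
      then show ?thesis by (rule trans[OF _ sum_swap3])
    qed
    also have "\<dots> = (\<Sum>l=1..<j. real l * tr_pow (j - l) M * (2 * (tr_pow (gap l j) M - tr_pow (l + j) M))
         + real (j - l) * tr_pow l M * (2 * (tr_pow (gap (j - l) j) M - tr_pow ((j - l) + j) M))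
         - real (?g l) * (2 * (tr_pow (gap (?g l) j) M - tr_pow (?g l + j) M)))"
      by (simp only: sum.distrib sum_subtractf sum_distrib_left[symmetric] sum_skew_skew[OF M])
    also have "\<dots> = 2 * (\<Sum>l=1..<j. T l M)"
      unfolding sum_distrib_left
    proof (rule sum.cong[OF refl])
      fix l assume "l \<in> {1..<j}"
      then have "gap l j = j - l" "gap (j - l) j = l" by (auto simp: gap_def)
      then show "real l * tr_pow (j - l) M * (2 * (tr_pow (gap l j) M - tr_pow (l + j) M))
         + real (j - l) * tr_pow l M * (2 * (tr_pow (gap (j - l) j) M - tr_pow ((j - l) + j) M))
         - real (?g l) * (2 * (tr_pow (gap (?g l) j) M - tr_pow (?g l + j) M)) = 2 * T l M"
        by (simp add: T_def algebra_simps)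
    qed
    finally show "(\<Sum>a<n. \<Sum>b<n. D a b M * skew j a b M) = 2 * (\<Sum>l=1..<j. T l M)" .
  qed
  also have "\<dots> = 2 * (\<Sum>l=1..<j. \<integral>M. T l M \<partial>\<mu>)"
    by (simp add: T_def)
  finally have "(\<integral>M. defect j M * ((real n - 1) * centred j M + defect j M) \<partial>\<mu>)
      = (\<Sum>l=1..<j. \<integral>M. T l M \<partial>\<mu>)"
    using schwinger_dyson_centred[OF d j(1)] by simp
  moreover have "(\<integral>M. defect j M * ((real n - 1) * centred j M + defect j M) \<partial>\<mu>)
    = (\<integral>M. defect j M * defect j M \<partial>\<mu>)"
  proof -
    have "(\<integral>M. defect j M * ((real n - 1) * centred j M + defect j M) \<partial>\<mu>)
      = (\<integral>M. (real n - 1) * (centred j M * defect j M) + defect j M * defect j M \<partial>\<mu>)"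
      by (simp add: algebra_simps)
    also have "\<dots> = (real n - 1) * (\<integral>M. centred j M * defect j M \<partial>\<mu>) + (\<integral>M. defect j M * defect j M \<partial>\<mu>)"
      by (subst Bochner_Integration.integral_add)
        (auto intro!: integrable_bdd bdd_meas_intros bdd_meas_centred bdd_meas_defect)
    finally show ?thesis by (simp add: centred_defect_orthogonal[OF j])
  qed
  moreover have "(\<integral>M. T l M \<partial>\<mu>) \<le> 3 * real j ^ 2" if l: "l \<in> {1..<j}" for l
  proof -
    have g: "?g l < j" using l by (auto simp: gap_def)
    have gg: "1 \<le> gap (?g l) j" "gap (?g l) j < n" using g j by (auto simp: gap_def)
    have mean: "0 \<le> mean_pow n k" "mean_pow n k * mean_pow n k \<le> 1" "mean_pow n k \<le> 1" if "k \<ge> 1" for k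
      using that by (auto simp: mean_pow_def)
    have "(\<integral>M. T l M \<partial>\<mu>) = 
        real l * (mean_pow n (j - l) * mean_pow n (j - l) + real (j - l) - mean_pow n (j - l) * mean_pow n (l + j))
      + real (j - l) * (mean_pow n l * mean_pow n l + real l - mean_pow n l * mean_pow n ((j - l) + j))
      - real (?g l) * (mean_pow n (gap (?g l) j) - mean_pow n (?g l + j))"
    proof -
      have "(\<integral>M. tr_pow (j - l) M * tr_pow (j - l) M \<partial>\<mu>) = mean_pow n (j - l) * mean_pow n (j - l) + real (j - l)"
        "(\<integral>M. tr_pow (j - l) M * tr_pow (l + j) M \<partial>\<mu>) = mean_pow n (j - l) * mean_pow n (l + j)"
        "(\<integral>M. tr_pow l M * tr_pow l M \<partial>\<mu>) = mean_pow n l * mean_pow n l + real l"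
        "(\<integral>M. tr_pow l M * tr_pow ((j - l) + j) M \<partial>\<mu>) = mean_pow n l * mean_pow n ((j - l) + j)"
        "(\<integral>M. tr_pow (gap (?g l) j) M \<partial>\<mu>) = mean_pow n (gap (?g l) j)"
        "(\<integral>M. tr_pow (?g l + j) M \<partial>\<mu>) = mean_pow n (?g l + j)"
        using l j g gg
        by ((subst expectation_tr_pow_mult; (linarith | auto)), (subst expectation_tr_pow_mult; (linarith | auto)),
            (subst expectation_tr_pow_mult; (linarith | auto)), (subst expectation_tr_pow_mult; (linarith | auto)),
            (subst expectation_tr_pow; (linarith | auto)), (subst expectation_tr_pow; (linarith | auto)))
      note e = this
      have "(\<integral>M. T l M \<partial>\<mu>) =
        real l * ((\<integral>M. tr_pow (j - l) M * tr_pow (j - l) M \<partial>\<mu>) - (\<integral>M. tr_pow (j - l) M * tr_pow (l + j) M \<partial>\<mu>))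
      + real (j - l) * ((\<integral>M. tr_pow l M * tr_pow l M \<partial>\<mu>) - (\<integral>M. tr_pow l M * tr_pow ((j - l) + j) M \<partial>\<mu>))
      - real (?g l) * ((\<integral>M. tr_pow (gap (?g l) j) M \<partial>\<mu>) - (\<integral>M. tr_pow (?g l + j) M \<partial>\<mu>))"
        by (simp add: T_def)
      then show ?thesis unfolding e .
    qed
    also have "\<dots> \<le> real j * real j + real j * real j + real j * real j"
    proof -
      have "real l * (mean_pow n (j - l) * mean_pow n (j - l) + real (j - l) - mean_pow n (j - l) * mean_pow n (l + j))
         \<le> real l * (1 + real (j - l) - 0)"
        using l by (intro mult_left_mono diff_mono add_mono mean mult_nonneg_nonneg) auto
      also have "\<dots> \<le> real j * real j" using l by (intro mult_mono) auto
      finally have 1: "real l * (mean_pow n (j - l) * mean_pow n (j - l) + real (j - l)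
         - mean_pow n (j - l) * mean_pow n (l + j)) \<le> real j * real j" .
      have "real (j - l) * (mean_pow n l * mean_pow n l + real l - mean_pow n l * mean_pow n ((j - l) + j))
         \<le> real (j - l) * (1 + real l - 0)"
        using l by (intro mult_left_mono diff_mono add_mono mean mult_nonneg_nonneg) auto
      also have "\<dots> \<le> real j * real j" using l by (intro mult_mono) auto
      finally have 2: "real (j - l) * (mean_pow n l * mean_pow n l + real l
         - mean_pow n l * mean_pow n ((j - l) + j)) \<le> real j * real j" .
      have "real (?g l) * (mean_pow n (?g l + j) - mean_pow n (gap (?g l) j)) \<le> real (?g l) * (1 - 0)"
        using j gg by (intro mult_left_mono diff_mono mean) auto
      also have "\<dots> \<le> real j * real j" using g j by (intro mult_mono) auto
      finally have 3: "real (?g l) * (mean_pow n (?g l + j) - mean_pow n (gap (?g l) j)) \<le> real j * real j" .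
      show ?thesis using 1 2 3 by (simp add: algebra_simps)
    qed
    finally show ?thesis by (simp add: power2_eq_square)
  qed
  then have "(\<Sum>l=1..<j. \<integral>M. T l M \<partial>\<mu>) \<le> (\<Sum>l=1..<j. 3 * real j ^ 2)"
    by (rule sum_mono)
  moreover have "(\<Sum>l=1..<j. 3 * real j ^ 2) \<le> real j * (3 * real j ^ 2)"
    using j by (simp add: mult_right_mono)
  ultimately show ?thesis by (simp add: power3_eq_cube power2_eq_square)
qed

lemma W_eq: "j \<ge> 1 \<Longrightarrow> W j M = centred j M * (1 / sqrt (real j))"
  by (auto simp: W_def centred_def tr_pow_def mean_pow_def)

text \<open>
  The hypothesis \<open>4 j < n\<close>, and not only \<open>2 j < n\<close>, enters through the variance of \<open>p\<^bsub>2j\<^esub>\<close>. Both absolute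
  moments are reduced to second moments by \<open>\<bar>x\<bar> \<le> (x\<^sup>2 / c + c) / 2\<close>, with \<open>c\<close> the expected size of \<open>x\<close>:
  \<open>j\<^bsup>3/2\<^esup>\<close> for the defect and \<open>j\<close> for \<open>1 - p\<^bsub>2j\<^esub>\<close>.
\<close>

theorem stein_discrepancy:
  assumes j: "j \<ge> 1" "4 * j < n"
    and f: "\<And>x. (f has_real_derivative f' x) (at x)"
    and f': "f' \<in> borel_measurable borel"
    and bound: "\<And>x. \<bar>f x\<bar> \<le> K" "\<And>x. \<bar>f' x\<bar> \<le> K'"
  shows "\<bar>\<integral>M. f' (W j M) - W j M * f (W j M) \<partial>\<mu>\<bar> \<le> 2 * (K + K') * real j / (real n - 1)"
proof -
  have n1: "real n - 1 > 0" using j by simp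
  have sj: "sqrt (real j) > 0" "sqrt (real j) * sqrt (real j) = real j" using j by auto
  have K: "K \<ge> 0" "K' \<ge> 0" using bound[of 0] by linarith+
  have dW: "rot_deriv n (W j) (\<lambda>a b M. sqrt (real j) * skew j a b M)"
  proof -
    have "rot_deriv n (\<lambda>M. centred j M * (1 / sqrt (real j)))
       (\<lambda>a b M. (real j * skew j a b M - 0) * (1 / sqrt (real j)) + 0 * centred j M)"
      unfolding centred_def by (intro rot_deriv_mult rot_deriv_diff rot_deriv_tr_pow rot_deriv_const)
    moreover have "real j * skew j a b M * (1 / sqrt (real j)) = sqrt (real j) * skew j a b M" for a b M
      using sj by (simp add: field_simps)
    moreover have "W j = (\<lambda>M. centred j M * (1 / sqrt (real j)))"
      by (rule ext) (rule W_eq[OF j(1)])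
    ultimately show ?thesis by simp
  qed
  have dF: "rot_deriv n (\<lambda>M. f (W j M)) (\<lambda>a b M. f' (W j M) * (sqrt (real j) * skew j a b M))"
    by (rule rot_deriv_compose[OF dW f f' bound])
  have bW: "bdd_meas n (W j)" and bfW: "bdd_meas n (\<lambda>M. f (W j M))"
    using dW dF by (auto simp: rot_deriv_def)
  have bf'W: "bdd_meas n (\<lambda>M. f' (W j M))"
    using bW bound(2) measurable_compose[OF _ f', of "W j"] by (auto simp: bdd_meas_def)
  have "(\<integral>M. (\<Sum>a<n. \<Sum>b<n. f' (W j M) * (sqrt (real j) * skew j a b M) * skew j a b M) \<partial>\<mu>)
     = (\<integral>M. 2 * sqrt (real j) * (f' (W j M) * (real n - tr_pow (2 * j) M)) \<partial>\<mu>)"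
  proof (rule Bochner_Integration.integral_cong[OF refl])
    fix M assume "M \<in> space \<mu>"
    then have M: "M \<in> SO n" by simp
    have "(\<Sum>a<n. \<Sum>b<n. f' (W j M) * (sqrt (real j) * skew j a b M) * skew j a b M)
      = f' (W j M) * sqrt (real j) * (\<Sum>a<n. \<Sum>b<n. skew j a b M * skew j a b M)"
      by (simp add: sum_distrib_left mult_ac)
    then show "(\<Sum>a<n. \<Sum>b<n. f' (W j M) * (sqrt (real j) * skew j a b M) * skew j a b M)
      = 2 * sqrt (real j) * (f' (W j M) * (real n - tr_pow (2 * j) M))"
      by (simp only: sum_skew_square[OF M] mult_ac)
  qed
  then have sd: "(\<integral>M. f (W j M) * ((real n - 1) * centred j M + defect j M) \<partial>\<mu>)
     = sqrt (real j) * (\<integral>M. f' (W j M) * (real n - tr_pow (2 * j) M) \<partial>\<mu>)"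
    using schwinger_dyson_centred[OF dF j(1)] by simp
  define R where "R = (\<lambda>M. f (W j M) * defect j M / sqrt (real j)
      - f' (W j M) * (1 - tr_pow (2 * j) M))"
  have key: "(real n - 1) * (\<integral>M. f' (W j M) - W j M * f (W j M) \<partial>\<mu>) = (\<integral>M. R M \<partial>\<mu>)"
  proof -
    have c: "centred j M = sqrt (real j) * W j M" for M
      using j sj by (simp add: W_eq)
    have "sqrt (real j) * ((real n - 1) * (\<integral>M. f' (W j M) - W j M * f (W j M) \<partial>\<mu>) - (\<integral>M. R M \<partial>\<mu>))
      = (\<integral>M. sqrt (real j) * ((real n - 1) * (f' (W j M) - W j M * f (W j M)) - R M) \<partial>\<mu>)"
      unfolding R_def divide_inverse
      by (subst Bochner_Integration.integral_mult_right_zero,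
          subst Bochner_Integration.integral_diff, 
          auto intro!: integrable_bdd bdd_meas_intros bW bfW bf'W bdd_meas_defect)
    also have "\<dots> = (\<integral>M. sqrt (real j) * (f' (W j M) * (real n - tr_pow (2 * j) M))
         - f (W j M) * ((real n - 1) * centred j M + defect j M) \<partial>\<mu>)"
      using sj by (intro Bochner_Integration.integral_cong refl)
        (simp add: R_def c field_simps)
    also have "\<dots> = sqrt (real j) * (\<integral>M. f' (W j M) * (real n - tr_pow (2 * j) M) \<partial>\<mu>)
       - (\<integral>M. f (W j M) * ((real n - 1) * centred j M + defect j M) \<partial>\<mu>)"
      by (subst Bochner_Integration.integral_diff)
        (auto intro!: integrable_bdd bdd_meas_intros bW bfW bf'W bdd_meas_defect bdd_meas_centred)
    also have "\<dots> = 0" by (simp add: sd)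
    finally show ?thesis using sj by simp
  qed
  \<comment> \<open>The order of magnitude of the defect.\<close>
  define a where "a = real j * sqrt (real j)"
  have a: "a > 0" using j sj by (simp add: a_def)
  \<comment> \<open>\<open>Q\<close> is the second-moment majorant of \<open>\<bar>R\<bar>\<close>.\<close>
  define Q where "Q = (\<lambda>M. K / (2 * sqrt (real j)) * (defect j M * defect j M / a + a)
     + K' / 2 * ((1 - 2 * tr_pow (2 * j) M + tr_pow (2 * j) M * tr_pow (2 * j) M) / real j + real j))"
  have amgm: "\<bar>x\<bar> \<le> (x * x / c + c) / 2" if "c > 0" for x c :: real
  proof -
    have "0 \<le> (\<bar>x\<bar> - c)\<^sup>2" by simp
    then have "2 * c * \<bar>x\<bar> \<le> x * x + c * c" by (simp add: power2_eq_square algebra_simps)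
    then show ?thesis using that by (simp add: field_simps)
  qed
  have RQ: "\<bar>R M\<bar> \<le> Q M" for M
  proof -
    have "\<bar>f (W j M) * defect j M / sqrt (real j)\<bar> \<le> K * ((defect j M * defect j M / a + a) / 2) / sqrt (real j)"
      unfolding abs_mult abs_divide using sj K bound(1) amgm[OF a]
      by (intro divide_mono mult_mono) auto
    moreover have "\<bar>f' (W j M) * (1 - tr_pow (2 * j) M)\<bar>
      \<le> K' * (((1 - tr_pow (2 * j) M) * (1 - tr_pow (2 * j) M) / real j + real j) / 2)"
      unfolding abs_mult using j K bound(2) amgm[of "real j"] by (intro mult_mono) auto
    ultimately have "\<bar>R M\<bar> \<le> K * ((defect j M * defect j M / a + a) / 2) / sqrt (real j)
      + K' * (((1 - tr_pow (2 * j) M) * (1 - tr_pow (2 * j) M) / real j + real j) / 2)"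
      unfolding R_def by linarith
    also have "(1 - tr_pow (2 * j) M) * (1 - tr_pow (2 * j) M)
        = 1 - 2 * tr_pow (2 * j) M + tr_pow (2 * j) M * tr_pow (2 * j) M"
      by (simp add: algebra_simps)
    finally have "\<bar>R M\<bar> \<le> K * ((defect j M * defect j M / a + a) / 2) / sqrt (real j)
      + K' * (((1 - 2 * tr_pow (2 * j) M + tr_pow (2 * j) M * tr_pow (2 * j) M) / real j + real j) / 2)" .
    also have "\<dots> = Q M" by (simp add: Q_def)
    finally show ?thesis .
  qed
  have bR: "bdd_meas n R" and bQ: "bdd_meas n Q"
    unfolding R_def Q_def divide_inverse
    by (intro bdd_meas_intros bW bfW bf'W bdd_meas_defect)+
  have "\<bar>\<integral>M. R M \<partial>\<mu>\<bar> \<le> (\<integral>M. \<bar>R M\<bar> \<partial>\<mu>)"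
    by (rule integral_abs_bound)
  also have "\<dots> \<le> (\<integral>M. Q M \<partial>\<mu>)"
    using RQ by (intro integral_mono integrable_abs integrable_bdd bR bQ)
  also have "\<dots> = K / (2 * sqrt (real j)) * ((\<integral>M. defect j M * defect j M \<partial>\<mu>) / a + a)
     + K' / 2 * ((1 - 2 * mean_pow n (2 * j) + (mean_pow n (2 * j) * mean_pow n (2 * j) + real (2 * j))) / real j + real j)"
  proof -
    have i: "integrable \<mu> (\<lambda>M. defect j M * defect j M)"
      by (intro integrable_bdd bdd_meas_intros bdd_meas_defect)
    show ?thesis
      using j i by (simp add: Q_def prob_space expectation_tr_pow expectation_tr_pow_mult)
  qed
  also have "\<dots> \<le> K / (2 * sqrt (real j)) * (3 * a + a) + K' / 2 * (2 + real j)"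
  proof -
    have "(\<integral>M. defect j M * defect j M \<partial>\<mu>) / a \<le> 3 * a"
    proof -
      have "real j ^ 3 = a * a" using sj by (simp add: a_def power3_eq_cube algebra_simps)
      then have "(\<integral>M. defect j M * defect j M \<partial>\<mu>) \<le> 3 * (a * a)"
        using expectation_defect_square[of j] j by simp
      then show ?thesis using a by (simp add: field_simps)
    qed
    moreover have "(1 - 2 * mean_pow n (2 * j) + (mean_pow n (2 * j) * mean_pow n (2 * j) + real (2 * j))) / real j = 2"
      using j by (simp add: mean_pow_def)
    ultimately show ?thesis using K sj by (intro add_mono mult_left_mono) auto
  qed
  also have "\<dots> \<le> 2 * (K + K') * real j"
  proof -
    have "K / (2 * sqrt (real j)) * (3 * a + a) = 2 * K * real j"
      using sj by (simp add: a_def field_simps)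
    moreover have "K' / 2 * (2 + real j) \<le> K' / 2 * (4 * real j)"
      using K j by (intro mult_left_mono) auto
    ultimately show ?thesis by (simp add: algebra_simps)
  qed
  finally have "\<bar>(real n - 1) * (\<integral>M. f' (W j M) - W j M * f (W j M) \<partial>\<mu>)\<bar> \<le> 2 * (K + K') * real j"
    by (simp add: key)
  then show ?thesis using n1 by (simp add: abs_mult field_simps)
qed

end

section \<open>The Stein equation of the normal distribution\<close>

definition gauss :: "real \<Rightarrow> real" where
  "gauss x = exp (- x\<^sup>2 / 2)"

lemma gauss_pos: "gauss x > 0"
  by (simp add: gauss_def)

lemma gauss_measurable [measurable]: "gauss \<in> borel_measurable borel"
  unfolding gauss_def by measurable

lemma integrable_std_normal_density: "integrable lborel std_normal_density"
  and integral_std_normal_density: "(\<integral>x. std_normal_density x \<partial>lborel) = 1"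
  by simp_all

lemma gauss_density: "gauss x = sqrt (2 * pi) * std_normal_density x"
  by (simp add: gauss_def std_normal_density_def)

lemma integrable_gauss [simp]: "integrable lborel gauss"
  and integral_gauss: "(\<integral>x. gauss x \<partial>lborel) = sqrt (2 * pi)"
  by (simp_all add: gauss_density[abs_def])

lemma integrable_indicator_gauss [simp]: "A \<in> sets borel \<Longrightarrow> integrable lborel (\<lambda>x. indicator A x * gauss x)"
  using integrable_mult_indicator[of A lborel gauss] by simp

text \<open>
  For \<open>x \<ge> w \<ge> 0\<close> the inequality \<open>x\<^sup>2 \<ge> w\<^sup>2 + (x - w)\<^sup>2\<close> bounds the tail by \<open>gauss w\<close> times a shifted
  Gaussian integral, and \<open>sqrt (2 * pi) \<le> 3\<close>.
\<close>

lemma tail_le_gauss: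
  assumes "w \<ge> 0"
  shows "(\<integral>x. indicator {w..} x * gauss x \<partial>lborel) \<le> 3 * gauss w"
proof -
  have "(\<integral>x. indicator {w..} x * gauss x \<partial>lborel)
     \<le> (\<integral>x. gauss w * (sqrt (2 * pi) * normal_density w 1 x) \<partial>lborel)"
  proof (rule integral_mono)
    show "integrable lborel (\<lambda>x. gauss w * (sqrt (2 * pi) * normal_density w 1 x))" by simp
    fix x :: real
    show "indicator {w..} x * gauss x \<le> gauss w * (sqrt (2 * pi) * normal_density w 1 x)"
    proof (cases "w \<le> x")
      case True
      have "0 \<le> 2 * (w * (x - w))" using assms True by simp
      then have "- x\<^sup>2 / 2 \<le> - w\<^sup>2 / 2 + - (x - w)\<^sup>2 / 2"
        by (simp add: power2_eq_square algebra_simps)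
      then have "gauss x \<le> exp (- w\<^sup>2 / 2 + - (x - w)\<^sup>2 / 2)" by (simp only: gauss_def exp_le_cancel_iff)
      also have "\<dots> = gauss w * (sqrt (2 * pi) * normal_density w 1 x)"
        by (simp only: exp_add gauss_def) (simp add: normal_density_def)
      finally show ?thesis using True by simp
    qed (simp add: gauss_pos less_imp_le)
  qed simp
  also have "\<dots> = sqrt (2 * pi) * gauss w" by simp
  also have "sqrt (2 * pi) \<le> sqrt (3\<^sup>2)"
    using pi_less_4 by (intro real_sqrt_le_mono) simp
  then have "sqrt (2 * pi) * gauss w \<le> 3 * gauss w"
    using gauss_pos[of w] by (intro mult_right_mono) auto
  finally show ?thesis .
qed

text \<open>
  On the domain of integration \<open>w \<le> x\<close>, and \<open>x * gauss x\<close> has the antiderivative \<open>- gauss x\<close>.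
\<close>

lemma mills_ratio:
  assumes "w \<ge> 0"
  shows "w * (\<integral>x. indicator {w..} x * gauss x \<partial>lborel) \<le> gauss w"
proof -
  have "(\<integral>\<^sup>+x. ennreal (x * gauss x) * indicator {w..} x \<partial>lborel) = ennreal (0 - (- gauss w))"
  proof (rule nn_integral_FTC_atLeast)
    have "((\<lambda>x::real. - exp (- (x\<^sup>2 / 2))) \<longlongrightarrow> - 0) at_top"
      by (intro tendsto_minus filterlim_compose[OF exp_at_bot]
          filterlim_compose[OF filterlim_uminus_at_bot_at_top]
          filterlim_at_top_mult_tendsto_pos[of "\<lambda>_. 1/2" "1/2" _ "\<lambda>x. x\<^sup>2", simplified]
          filterlim_pow_at_top filterlim_ident) auto
    then show "((\<lambda>x. - gauss x) \<longlongrightarrow> 0) at_top" by (simp add: gauss_def)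
    show "((\<lambda>x. - gauss x) has_real_derivative x * gauss x) (at x)" for x
      unfolding gauss_def by (auto intro!: derivative_eq_intros)
  qed (use assms gauss_pos in \<open>auto simp: less_imp_le\<close>)
  then have nn: "(\<integral>\<^sup>+x. ennreal (indicator {w..} x * (x * gauss x)) \<partial>lborel) = ennreal (gauss w)"
    by (subst nn_integral_cong[where v = "\<lambda>x. ennreal (x * gauss x) * indicator {w..} x"])
      (auto simp: indicator_def)
  have nonneg: "0 \<le> indicator {w..} x * (x * gauss x)" for x
    using assms gauss_pos[of x] by (auto simp: indicator_def)
  have hb: "has_bochner_integral lborel (\<lambda>x. indicator {w..} x * (x * gauss x)) (gauss w)"
    by (rule has_bochner_integral_nn_integral)
      (use nn nonneg gauss_pos[of w] in \<open>auto simp: less_imp_le\<close>)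
  have "(\<integral>x. w * (indicator {w..} x * gauss x) \<partial>lborel) \<le> (\<integral>x. indicator {w..} x * (x * gauss x) \<partial>lborel)"
  proof (rule integral_mono)
    show "integrable lborel (\<lambda>x. indicator {w..} x * (x * gauss x))"
      using hb by (simp add: has_bochner_integral_iff)
    show "w * (indicator {w..} x * gauss x) \<le> indicator {w..} x * (x * gauss x)" for x
      using gauss_pos[of x] by (auto simp: indicator_def intro: mult_right_mono)
  qed simp
  then show ?thesis using hb by (simp add: has_bochner_integral_iff)
qed

lemma reflect_tail:
  "(\<integral>x. indicator {..w} x * gauss x \<partial>lborel) = (\<integral>x. indicator {- w..} x * gauss x \<partial>lborel)"
proof -
  have "(\<integral>x. indicator {..w} x * gauss x \<partial>lborel) = (\<integral>x. indicator {..w} (- x) * gauss (- x) \<partial>lborel)"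
    using lborel_integral_real_affine[of "-1" "\<lambda>x. indicator {..w} x * gauss x" 0] by simp
  also have "\<dots> = (\<integral>x. indicator {- w..} x * gauss x \<partial>lborel)"
    by (intro Bochner_Integration.integral_cong refl) (auto simp: gauss_def indicator_def)
  finally show ?thesis .
qed

lemma antiderivative_from_minus_infinity:
  fixes g :: "real \<Rightarrow> real"
  assumes "integrable lborel g" "continuous_on UNIV g"
  shows "((\<lambda>w. \<integral>x. indicator {..<w} x * g x \<partial>lborel) has_real_derivative g w) (at w)"
proof -
  have G: "(\<integral>x. indicator {..<u} x * g x \<partial>lborel) = (LBINT x=-\<infinity>..ereal u. g x)" for u
    by (simp add: interval_lebesgue_integral_def set_lebesgue_integral_def)
  have int: "interval_lebesgue_integrable lborel a b g" for a b
    using assms(1) by (auto simp: interval_lebesgue_integrable_def set_integrable_def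
        intro!: integrable_mult_indicator[of _ lborel g, simplified])
  have eq: "(\<integral>x. indicator {..<u} x * g x \<partial>lborel)
     = (LBINT x=-\<infinity>..0. g x) + (LBINT x=0..u. g x)" for u :: real
    unfolding G by (rule interval_integral_sum[symmetric, OF int])
  define a b where "a = min 0 w - 1" and "b = max 0 w + 1"
  have "((\<lambda>u. LBINT y=ereal 0..ereal u. g y) has_vector_derivative g w) (at w within {a..b})"
    by (rule interval_integral_FTC2)
      (use assms(2) in \<open>auto simp: a_def b_def intro: continuous_on_subset\<close>)
  moreover have "at w within {a..b} = at w"
    by (rule at_within_Icc_at) (auto simp: a_def b_def)
  ultimately have "((\<lambda>u. LBINT y=ereal 0..ereal u. g y) has_real_derivative g w) (at w)"
    by (simp add: has_real_derivative_iff_has_vector_derivative)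
  then show ?thesis
    unfolding eq by (auto intro!: derivative_eq_intros simp: zero_ereal_def)
qed

text \<open>
  The solution is \<open>f w = exp (w\<^sup>2 / 2) * G w\<close>, where \<open>G w\<close> integrates \<open>g x = (h x - c) * gauss x\<close> over \<open>x < w\<close>.
  As \<open>g\<close> has total integral \<open>0\<close>, \<open>G w\<close> is also minus the integral over \<open>x \<ge> w\<close>; hence for either sign of \<open>w\<close>
  it is bounded by a Gaussian tail from \<open>\<bar>w\<bar>\<close>, and the two tail estimates bound \<open>f w\<close> and \<open>w * f w\<close>.
\<close>

lemma stein_equation_solution:
  fixes h :: "real \<Rightarrow> real"
  assumes h: "continuous_on UNIV h" "\<And>x. 0 \<le> h x" "\<And>x. h x \<le> 1"
  defines "c \<equiv> \<integral>x. h x * std_normal_density x \<partial>lborel"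
  obtains f :: "real \<Rightarrow> real" where
    "\<And>x. (f has_real_derivative x * f x + h x - c) (at x)"
    "\<And>x. \<bar>f x\<bar> \<le> 3" "\<And>x. \<bar>x * f x + h x - c\<bar> \<le> 2"
proof -
  have hm [measurable]: "h \<in> borel_measurable borel"
    using h(1) by (rule borel_measurable_continuous_onI)
  have ih: "integrable lborel (\<lambda>x. h x * std_normal_density x)"
    by (rule Bochner_Integration.integrable_bound[OF integrable_std_normal_density])
      (use h in \<open>auto simp: abs_mult intro!: mult_left_le_one_le\<close>)
  have c: "0 \<le> c" "c \<le> 1"
  proof -
    show "0 \<le> c" unfolding c_def using h by (intro integral_nonneg_AE) auto
    have "c \<le> (\<integral>x. std_normal_density x \<partial>lborel)"
      unfolding c_def using ih h by (intro integral_mono) (auto intro!: mult_left_le_one_le)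
    then show "c \<le> 1" by simp
  qed
  define g where "g = (\<lambda>x. (h x - c) * gauss x)"
  have hc: "\<bar>h x - c\<bar> \<le> 1" for x using h(2,3)[of x] c by linarith
  have gle: "\<bar>g x\<bar> \<le> gauss x" for x
    using hc[of x] gauss_pos[of x] by (simp add: g_def abs_mult mult_left_le_one_le)
  have gm [measurable]: "g \<in> borel_measurable borel" unfolding g_def by measurable
  have ig: "integrable lborel g"
    by (rule Bochner_Integration.integrable_bound[OF integrable_gauss])
      (use gle gauss_pos in \<open>auto simp: less_imp_le\<close>)
  have total: "(\<integral>x. g x \<partial>lborel) = 0"
  proof -
    have "(\<integral>x. g x \<partial>lborel) = (\<integral>x. sqrt (2 * pi) * (h x * std_normal_density x - c * std_normal_density x) \<partial>lborel)"
      by (simp add: g_def gauss_density algebra_simps)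
    also have "\<dots> = 0" using ih by (simp add: c_def)
    finally show ?thesis .
  qed
  have gcont: "continuous_on UNIV g"
    unfolding g_def gauss_def by (intro continuous_intros h) auto
  have igi: "integrable lborel (\<lambda>x. indicator A x * g x)" if "A \<in> sets borel" for A
    using integrable_mult_indicator[of A lborel g] ig that by simp
  have bound: "\<bar>\<integral>x. indicator A x * g x \<partial>lborel\<bar> \<le> (\<integral>x. indicator B x * gauss x \<partial>lborel)"
    if "A \<in> sets borel" "B \<in> sets borel" "A \<subseteq> B" for A B
  proof -
    have "\<bar>\<integral>x. indicator A x * g x \<partial>lborel\<bar> \<le> (\<integral>x. \<bar>indicator A x * g x\<bar> \<partial>lborel)"
      by (rule integral_abs_bound)
    also have "\<dots> \<le> (\<integral>x. indicator B x * gauss x \<partial>lborel)"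
    proof (rule integral_mono)
      show "integrable lborel (\<lambda>x. \<bar>indicator A x * g x\<bar>)"
        by (rule integrable_abs[OF igi[OF that(1)]])
      show "integrable lborel (\<lambda>x. indicator B x * gauss x)"
        by (rule integrable_indicator_gauss[OF that(2)])
      show "\<bar>indicator A x * g x\<bar> \<le> indicator B x * gauss x" for x
        using that(3) gle[of x] gauss_pos[of x] by (auto simp: abs_mult indicator_def less_imp_le)
    qed
    finally show ?thesis .
  qed
  define G where "G = (\<lambda>w. \<integral>x. indicator {..<w} x * g x \<partial>lborel)"
  have Gtail: "\<bar>G w\<bar> \<le> (\<integral>x. indicator {\<bar>w\<bar>..} x * gauss x \<partial>lborel)" for w
  proof (cases "w \<ge> 0")
    case True
    have "(\<integral>x. g x \<partial>lborel) = (\<integral>x. indicator {..<w} x * g x + indicator {w..} x * g x \<partial>lborel)"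
      by (intro Bochner_Integration.integral_cong refl) (auto simp: indicator_def)
    also have "\<dots> = G w + (\<integral>x. indicator {w..} x * g x \<partial>lborel)"
      unfolding G_def by (intro Bochner_Integration.integral_add igi) auto
    finally have "\<bar>G w\<bar> = \<bar>\<integral>x. indicator {w..} x * g x \<partial>lborel\<bar>" using total by simp
    then show ?thesis using True bound[of "{w..}" "{w..}"] by simp
  next
    case False
    have "{..<w} \<subseteq> {..w}" by auto
    from False bound[OF _ _ this] show ?thesis by (simp add: G_def reflect_tail)
  qed
  define f where "f = (\<lambda>w. exp (w\<^sup>2 / 2) * G w)"
  have inv: "exp (w\<^sup>2 / 2) * gauss w = 1" for w
    by (simp add: gauss_def exp_minus flip: exp_add)
  have Gd: "(G has_real_derivative g w) (at w)" for w
    unfolding G_def by (rule antiderivative_from_minus_infinity[OF ig gcont])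
  have d: "(f has_real_derivative w * f w + h w - c) (at w)" for w
  proof -
    have "(f has_real_derivative exp (w\<^sup>2 / 2) * w * G w + g w * exp (w\<^sup>2 / 2)) (at w)"
      unfolding f_def by (rule DERIV_mult[OF _ Gd]) (auto intro!: derivative_eq_intros)
    moreover have "g w * exp (w\<^sup>2 / 2) = (h w - c) * (exp (w\<^sup>2 / 2) * gauss w)"
      by (simp add: g_def)
    then have "g w * exp (w\<^sup>2 / 2) = h w - c" by (simp only: inv mult_1_right)
    moreover have "exp (w\<^sup>2 / 2) * w * G w = w * f w" by (simp add: f_def)
    ultimately show ?thesis by (simp only: add_diff_eq)
  qed
  have gauss_abs: "gauss \<bar>w\<bar> = gauss w" for w by (simp add: gauss_def)
  have b1: "\<bar>f w\<bar> \<le> 3" for w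
  proof -
    have "\<bar>f w\<bar> = exp (w\<^sup>2 / 2) * \<bar>G w\<bar>" by (simp add: f_def abs_mult)
    also have "\<dots> \<le> exp (w\<^sup>2 / 2) * (3 * gauss w)"
      using order_trans[OF Gtail tail_le_gauss[of "\<bar>w\<bar>"]] by (intro mult_left_mono) (auto simp: gauss_abs)
    also have "\<dots> = 3" using inv[of w] by simp
    finally show ?thesis .
  qed
  have b2: "\<bar>w * f w + h w - c\<bar> \<le> 2" for w
  proof -
    have "\<bar>w * f w\<bar> = exp (w\<^sup>2 / 2) * (\<bar>w\<bar> * \<bar>G w\<bar>)" by (simp add: f_def abs_mult)
    also have "\<dots> \<le> exp (w\<^sup>2 / 2) * gauss w"
      using order_trans[OF mult_left_mono[OF Gtail[of w], of "\<bar>w\<bar>"] mills_ratio[of "\<bar>w\<bar>"]]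
      by (intro mult_left_mono) (auto simp: gauss_abs)
    also have "\<dots> = 1" by (rule inv)
    finally show ?thesis using hc[of w] by linarith
  qed
  show ?thesis using that[OF d b1 b2] .
qed

section \<open>From test functions to the distribution function\<close>

definition ramp :: "real \<Rightarrow> real \<Rightarrow> real \<Rightarrow> real" where
  "ramp y e x = max 0 (min 1 ((y + e - x) / e))"

lemma ramp_bounds: "0 \<le> ramp y e x" "ramp y e x \<le> 1"
  by (auto simp: ramp_def)

lemma ramp_left: "e > 0 \<Longrightarrow> x \<le> y \<Longrightarrow> ramp y e x = 1"
  by (auto simp: ramp_def)

lemma ramp_right: "e > 0 \<Longrightarrow> y + e \<le> x \<Longrightarrow> ramp y e x = 0"
  by (auto simp: ramp_def divide_le_0_iff)

lemma ramp_continuous: "e > 0 \<Longrightarrow> continuous_on UNIV (ramp y e)"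
  unfolding ramp_def by (intro continuous_intros) auto

context haar
begin

lemma W_measurable: "j \<ge> 1 \<Longrightarrow> W j \<in> borel_measurable (SO_borel n)"
  using bdd_meas_centred[of j]
  by (subst measurable_cong[where g = "\<lambda>M. centred j M * (1 / sqrt (real j))"])
    (auto simp: bdd_meas_def W_eq)

text \<open>
  The bound does not depend on the modulus of continuity of \<open>h\<close>, which is what allows steep ramps.
\<close>

lemma smooth_test_function_bound:
  assumes j: "j \<ge> 1" "4 * j < n"
    and h: "continuous_on UNIV h" "\<And>x. 0 \<le> h x" "\<And>x. h x \<le> 1"
  shows "\<bar>(\<integral>M. h (W j M) \<partial>\<mu>) - (\<integral>x. h x * std_normal_density x \<partial>lborel)\<bar> \<le> 20 * real j / real n"
proof -
  let ?c = "\<integral>x. h x * std_normal_density x \<partial>lborel"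
  obtain f where f: "\<And>x. (f has_real_derivative x * f x + h x - ?c) (at x)"
    "\<And>x. \<bar>f x\<bar> \<le> 3" "\<And>x. \<bar>x * f x + h x - ?c\<bar> \<le> 2"
    using stein_equation_solution[OF h] by blast
  have fc: "continuous_on UNIV f"
    using f(1) by (intro continuous_at_imp_continuous_on ballI DERIV_isCont) auto
  have m: "(\<lambda>x. x * f x + h x - ?c) \<in> borel_measurable borel"
    by (intro borel_measurable_continuous_onI continuous_intros fc h)
  have "\<bar>\<integral>M. (W j M * f (W j M) + h (W j M) - ?c) - W j M * f (W j M) \<partial>\<mu>\<bar>
    \<le> 2 * (3 + 2) * real j / (real n - 1)"
    by (rule stein_discrepancy[OF j f(1) m f(2,3)])
  also have "(\<integral>M. (W j M * f (W j M) + h (W j M) - ?c) - W j M * f (W j M) \<partial>\<mu>)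
      = (\<integral>M. h (W j M) - ?c \<partial>\<mu>)"
    by (intro Bochner_Integration.integral_cong refl) simp
  also have "\<dots> = (\<integral>M. h (W j M) \<partial>\<mu>) - ?c"
  proof -
    have "(\<lambda>M. h (W j M)) \<in> borel_measurable (SO_borel n)"
      by (rule measurable_compose[OF W_measurable[OF j(1)] borel_measurable_continuous_onI[OF h(1)]])
    then have "bdd_meas n (\<lambda>M. h (W j M))"
      by (rule bdd_measI[where B = 1]) (use h(2,3) in auto)
    then show ?thesis by (subst Bochner_Integration.integral_diff) (auto intro: integrable_bdd)
  qed
  also have "2 * (3 + 2) * real j / (real n - 1) \<le> 20 * real j / real n"
    using j by (simp add: field_simps)
  finally show ?thesis .
qed

text \<open>
  The indicator of \<open>{..x0}\<close> lies between the ramps that descend on \<open>[x0 - e, x0]\<close> and on \<open>[x0, x0 + e]\<close>.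
  Their normal expectations differ from the distribution function by at most \<open>e\<close>, since the normal density
  is at most \<open>1\<close>.
\<close>

lemma kolmogorov_bound:
  assumes j: "j \<ge> 1" "4 * j < n"
  shows "\<bar>measure \<mu> {M \<in> space \<mu>. W j M \<le> x0}
     - (\<integral>x. indicator {..x0} x * std_normal_density x \<partial>lborel)\<bar> \<le> 20 * real j / real n"
proof (rule field_le_epsilon)
  fix e :: real assume e: "e > 0"
  let ?Phi = "\<integral>x. indicator {..x0} x * std_normal_density x \<partial>lborel"
  let ?P = "measure \<mu> {M \<in> space \<mu>. W j M \<le> x0}"
  let ?N = "\<lambda>y. \<integral>x. ramp y e x * std_normal_density x \<partial>lborel"
  have Wm: "W j \<in> borel_measurable (SO_borel n)" by (rule W_measurable[OF j(1)])
  have A: "{M \<in> space \<mu>. W j M \<le> x0} \<in> sets \<mu>"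
    using Wm by (intro borel_measurable_le) simp_all
  have P: "?P = (\<integral>M. indicator {..x0} (W j M) \<partial>\<mu>)"
  proof -
    have "?P = measure \<mu> ({M \<in> space \<mu>. W j M \<le> x0} \<inter> space \<mu>)"
      by (rule arg_cong[where f = "measure \<mu>"]) blast
    also have "\<dots> = (\<integral>M. indicator {M \<in> space \<mu>. W j M \<le> x0} M \<partial>\<mu>)"
      by (rule Bochner_Integration.integral_indicator[symmetric])
    also have "\<dots> = (\<integral>M. indicator {..x0} (W j M) \<partial>\<mu>)"
      by (intro Bochner_Integration.integral_cong refl) (auto simp: indicator_def)
    finally show ?thesis .
  qed
  have bi: "bdd_meas n (\<lambda>M. indicator {..x0} (W j M))"
    using measurable_compose[OF Wm, of "indicator {..x0}" borel]
    by (intro bdd_measI[where B = 1]) (auto simp: indicator_def)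
  have br: "bdd_meas n (\<lambda>M. ramp y e (W j M))" for y
    using measurable_compose[OF Wm borel_measurable_continuous_onI[OF ramp_continuous[OF e, of y]]]
    by (intro bdd_measI[where B = 1]) (auto simp: ramp_bounds)
  have close: "\<bar>(\<integral>M. ramp y e (W j M) \<partial>\<mu>) - ?N y\<bar> \<le> 20 * real j / real n" for y
    by (rule smooth_test_function_bound[OF j ramp_continuous[OF e] ramp_bounds])
  have d1: "std_normal_density x \<le> 1" for x
  proof -
    have "1 \<le> sqrt (2 * pi)" using pi_gt3 by simp
    then have "std_normal_density x \<le> 1 * 1"
      unfolding std_normal_density_def by (intro mult_mono) auto
    then show ?thesis by simp
  qed
  have iPhi: "integrable lborel (\<lambda>x. indicator {..x0} x * std_normal_density x)"
    using integrable_mult_indicator[of "{..x0}" lborel std_normal_density] by simp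
  have iN: "integrable lborel (\<lambda>x. ramp y e x * std_normal_density x)" for y
    by (rule Bochner_Integration.integrable_bound[OF integrable_std_normal_density])
      (use ramp_bounds borel_measurable_continuous_onI[OF ramp_continuous[OF e, of y]]
        in \<open>auto simp: abs_mult intro!: mult_left_le_one_le\<close>)
  have ie: "integrable lborel (indicator {a..a + e} :: real \<Rightarrow> real)"
    "(\<integral>x. indicator {a..a + e} x \<partial>lborel) = e" for a
    using e by auto
  have up: "?N x0 \<le> ?Phi + e"
  proof -
    have "?N x0 \<le> (\<integral>x. indicator {..x0} x * std_normal_density x + indicator {x0..x0 + e} x \<partial>lborel)"
    proof (rule integral_mono[OF iN Bochner_Integration.integrable_add[OF iPhi ie(1)]])
      fix x
      have "ramp x0 e x * std_normal_density x \<le> 1 * std_normal_density x"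
        by (intro mult_right_mono ramp_bounds) auto
      then show "ramp x0 e x * std_normal_density x
        \<le> indicator {..x0} x * std_normal_density x + indicator {x0..x0 + e} x"
        using d1[of x] ramp_right[OF e, of x0 x] by (auto simp: indicator_def not_le)
    qed
    then show ?thesis using iPhi ie by simp
  qed
  have lo: "?Phi \<le> ?N (x0 - e) + e"
  proof -
    have "?Phi \<le> (\<integral>x. ramp (x0 - e) e x * std_normal_density x + indicator {x0 - e..x0 - e + e} x \<partial>lborel)"
    proof (rule integral_mono[OF iPhi Bochner_Integration.integrable_add[OF iN ie(1)]])
      fix x
      have "0 \<le> ramp (x0 - e) e x * std_normal_density x"
        by (intro mult_nonneg_nonneg ramp_bounds) auto
      then show "indicator {..x0} x * std_normal_density x
        \<le> ramp (x0 - e) e x * std_normal_density x + indicator {x0 - e..x0 - e + e} x"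
        using d1[of x] ramp_left[OF e, of x "x0 - e"] by (auto simp: indicator_def not_le)
    qed
    then show ?thesis using iN ie[of "x0 - e"] by simp
  qed
  have "?P \<le> (\<integral>M. ramp x0 e (W j M) \<partial>\<mu>)"
    unfolding P using ramp_left[OF e] ramp_bounds
    by (intro integral_mono integrable_bdd bi br) (auto simp: indicator_def)
  moreover have "(\<integral>M. ramp (x0 - e) e (W j M) \<partial>\<mu>) \<le> ?P"
    unfolding P using ramp_right[OF e, of "x0 - e"] ramp_bounds
    by (intro integral_mono integrable_bdd bi br) (auto simp: indicator_def)
  ultimately show "\<bar>?P - ?Phi\<bar> \<le> 20 * real j / real n + e"
    using close[of x0] close[of "x0 - e"] up lo unfolding abs_le_iff by linarith
qed

end

theorem theorem3p8:
  shows "\<exists>C::real. C > 0 \<and>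
    (\<forall>(n::nat) (j::nat) (x0::real) (\<mu> :: real mat measure).
       n \<ge> 1 \<longrightarrow> j \<ge> 1 \<longrightarrow> haar_prob_SO n \<mu> \<longrightarrow>
       \<bar>measure \<mu> {M \<in> space \<mu>. W j M \<le> x0}
          - 1 / sqrt (2 * pi) * (LBINT x:{..x0}. exp (- (x\<^sup>2) / 2))\<bar>
       \<le> C * real j / real n)"
proof (intro exI[of _ "20::real"] conjI allI impI)
  fix n j :: nat and x0 :: real and \<mu> :: "real mat measure"
  assume n: "n \<ge> 1" and j: "j \<ge> 1" and h: "haar_prob_SO n \<mu>"
  interpret haar n \<mu> by (rule haar.intro[OF h])
  let ?Phi = "\<integral>x. indicator {..x0} x * std_normal_density x \<partial>lborel"
  have Phi: "1 / sqrt (2 * pi) * (LBINT x:{..x0}. exp (- (x\<^sup>2) / 2)) = ?Phi"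
  proof -
    have "?Phi = (\<integral>x. 1 / sqrt (2 * pi) * (indicator {..x0} x *\<^sub>R exp (- (x\<^sup>2) / 2)) \<partial>lborel)"
      by (intro Bochner_Integration.integral_cong refl) (simp add: std_normal_density_def)
    also have "\<dots> = 1 / sqrt (2 * pi) * (LBINT x:{..x0}. exp (- (x\<^sup>2) / 2))"
      unfolding set_lebesgue_integral_def by (rule integral_mult_right_zero)
    finally show ?thesis ..
  qed
  show "\<bar>measure \<mu> {M \<in> space \<mu>. W j M \<le> x0}
          - 1 / sqrt (2 * pi) * (LBINT x:{..x0}. exp (- (x\<^sup>2) / 2))\<bar> \<le> 20 * real j / real n"
    unfolding Phi
  proof (cases "4 * j < n")
    case True
    with j show "\<bar>measure \<mu> {M \<in> space \<mu>. W j M \<le> x0} - ?Phi\<bar> \<le> 20 * real j / real n"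
      by (rule kolmogorov_bound)
  next
    case False
    then have "1 \<le> 20 * real j / real n" using n by (simp add: field_simps)
    moreover have "0 \<le> ?Phi" by (intro integral_nonneg_AE) auto
    moreover have "?Phi \<le> (\<integral>x. std_normal_density x \<partial>lborel)"
      using integrable_mult_indicator[of "{..x0}" lborel std_normal_density]
      by (intro integral_mono) (auto simp: indicator_def)
    moreover have "measure \<mu> {M \<in> space \<mu>. W j M \<le> x0} \<le> 1" by (rule prob_le_1)
    moreover have "0 \<le> measure \<mu> {M \<in> space \<mu>. W j M \<le> x0}" by (rule measure_nonneg)
    ultimately show "\<bar>measure \<mu> {M \<in> space \<mu>. W j M \<le> x0} - ?Phi\<bar> \<le> 20 * real j / real n"
      unfolding abs_le_iff integral_std_normal_density by linarith
  qed
qed simp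

end
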